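(* Let $k\in\mathbb{N}$ with $1\le k<N$, let $\Omega\subset\mathbb{R}^N$ be open, and let $U$ be a smooth subdomain of $\Omega$, that is, an open subset of $\Omega$ whose relative boundary $\Omega\cap\partial U$ can be represented locally as the graph of a smooth function. Let $\kappa_1\le\kappa_2\le\dots\le\kappa_{N-1}$ denote the principal curvatures of the hypersurface $\Omega\cap\partial U$. Then $$\sum_{i=1}^k\kappa_{N-i}\ge 0\quad\text{on }\Omega\cap\partial U$$ if and only if condition (G$_{\mathcal{P}^-_k,\Omega,U}$) holds.
   Context: For a real symmetric $N\times N$ matrix $X$ with eigenvalues $\lambda_1(X)\le\dots\le\lambda_N(X)$, $\mathcal{P}^-_k(X)=\sum_{i=1}^k\lambda_i(X)$. Condition (G$_{\mathcal{P}^-_k,\Omega,U}$): if $\phi\in C^2(\Omega)$, $\hat x\in\Omega\setminus U$ and $\phi\le\phi(\hat x)=0$ in $\Omega\setminus U$, then $\mathcal{P}^-_k(D^2\phi(\hat x))\le 0$. Local graph representation and sign convention for the principal curvatures: $U$ lies locally on one side of its relative boundary, in the sense that for every point of $\Omega\cap\partial U$, after a rigid transformation moving this point to the origin, there are $r>0$ with $B_r\subset\Omega$ and $f\in C^2(B_r^{N-1})$ with $f(0)=0$, $Df(0)=0$ such that $U\cap B_r=\{x=(x',x_N)\in B_r : x_N>f(x')\}$; the principal curvatures at this point are the eigenvalues of $D^2f(0)$. Here $B_r$ and $B_r^{N-1}$ are the open balls of radius $r$ centered at the origin in $\mathbb{R}^N$ and $\mathbb{R}^{N-1}$. *)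

theory Defs
  imports "HOL-Analysis.Analysis" "HOL-Computational_Algebra.Computational_Algebra"
begin

definition charpoly :: "real^'n^'n \<Rightarrow> real poly" where
  "charpoly A = det (mat [:0, 1:] - map_matrix (\<lambda>a. [:a:]) A)"

text \<open>
  The eigenvalues are listed in nondecreasing order and repeated according to their multiplicity
  as real roots of the characteristic polynomial, so that a symmetric matrix has \<open>CARD('n)\<close> of
  them.  They are numbered from 1; the value of \<open>eigenvalue A i\<close> is meaningful only for
  symmetric \<open>A\<close> and \<open>1 \<le> i \<le> CARD('n)\<close>.
\<close>

definition eigenvalue :: "real^'n^'n \<Rightarrow> nat \<Rightarrow> real" where
  "eigenvalue A i = sorted_list_of_multiset (proots (charpoly A)) ! (i - 1)"

definition P_minus :: "nat \<Rightarrow> real^'n^'n \<Rightarrow> real" where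
  "P_minus k X = (\<Sum>i=1..k. eigenvalue X i)"

definition gradient :: "(real^'n \<Rightarrow> real) \<Rightarrow> real^'n \<Rightarrow> real^'n" where
  "gradient f x = (\<chi> i. frechet_derivative f (at x) (axis i 1))"

definition hessian :: "(real^'n \<Rightarrow> real) \<Rightarrow> real^'n \<Rightarrow> real^'n^'n" where
  "hessian f x = jacobian (gradient f) (at x)"

text \<open>Intended for open \<open>S\<close>; then only the values of \<open>f\<close> on \<open>S\<close> matter.\<close>

definition C2_on :: "(real^'n) set \<Rightarrow> (real^'n \<Rightarrow> real) \<Rightarrow> bool" where
  "C2_on S f \<longleftrightarrow>
     (\<forall>x\<in>S. f differentiable (at x)) \<and>
     (\<forall>x\<in>S. gradient f differentiable (at x)) \<and>
     continuous_on S (hessian f)"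

definition condition_G :: "nat \<Rightarrow> (real^'n) set \<Rightarrow> (real^'n) set \<Rightarrow> bool" where
  "condition_G k \<Omega> U \<longleftrightarrow>
     (\<forall>\<phi> z. C2_on \<Omega> \<phi> \<longrightarrow> z \<in> \<Omega> - U \<longrightarrow> (\<forall>x\<in>\<Omega> - U. \<phi> x \<le> \<phi> z) \<longrightarrow> \<phi> z = 0 \<longrightarrow>
        P_minus k (hessian \<phi> z) \<le> 0)"

text \<open>
  Points of \<open>\<real>\<^sup>N\<close> are split as \<open>(x', x\<^sub>N)\<close>, an element of \<open>(real^'m) \<times> real\<close> with
  \<open>CARD('m) = N - 1\<close>.  The norm of the product type is the Euclidean one, so its balls are
  the balls of \<open>\<real>\<^sup>N\<close>, and a surjective isometry \<open>\<rho>\<close> onto it is a rigid transformation of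
  \<open>\<real>\<^sup>N\<close> expressed in the split coordinates.
\<close>

definition local_graph ::
    "(real^'n) set \<Rightarrow> (real^'n) set \<Rightarrow> real^'n \<Rightarrow>
     (real^'n \<Rightarrow> (real^'m) \<times> real) \<Rightarrow> real \<Rightarrow> (real^'m \<Rightarrow> real) \<Rightarrow> bool" where
  "local_graph \<Omega> U p \<rho> r f \<longleftrightarrow>
     surj \<rho> \<and> (\<forall>x y. dist (\<rho> x) (\<rho> y) = dist x y) \<and> \<rho> p = 0 \<and>
     r > 0 \<and> ball 0 r \<subseteq> \<rho> ` \<Omega> \<and>
     C2_on (ball 0 r) f \<and> f 0 = 0 \<and> gradient f 0 = 0 \<and>
     \<rho> ` U \<inter> ball 0 r = {(x', xN). (x', xN) \<in> ball 0 r \<and> xN > f x'}"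

text \<open>The \<open>itself\<close> argument fixes the index type \<open>'m\<close> of \<open>\<real>\<^sup>N\<^sup>-\<^sup>1\<close>.\<close>

definition smooth_subdomain ::
    "'m::finite itself \<Rightarrow> (real^'n) set \<Rightarrow> (real^'n) set \<Rightarrow> bool" where
  "smooth_subdomain _ \<Omega> U \<longleftrightarrow>
     open U \<and> U \<subseteq> \<Omega> \<and>
     (\<forall>p\<in>\<Omega> \<inter> frontier U. \<exists>\<rho> r (f :: real^'m \<Rightarrow> real). local_graph \<Omega> U p \<rho> r f)"

text \<open>
  The numbers \<open>c 1 \<le> \<dots> \<le> c (N - 1)\<close> are the principal curvatures of the relative boundary
  at \<open>p\<close>.  They are read off from a local graph representation; it does not matter from which.
\<close>

definition principal_curvatures_at ::
    "'m::finite itself \<Rightarrow> (real^'n) set \<Rightarrow> (real^'n) set \<Rightarrow> real^'n \<Rightarrow> (nat \<Rightarrow> real) \<Rightarrow> bool" where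
  "principal_curvatures_at _ \<Omega> U p c \<longleftrightarrow>
     (\<exists>\<rho> r (f :: real^'m \<Rightarrow> real). local_graph \<Omega> U p \<rho> r f \<and>
        (\<forall>i\<in>{1..CARD('m)}. c i = eigenvalue (hessian f 0) i))"

end

(* A local graph of \<Omega> \<inter> frontier U over its tangent plane turns the condition into a
   comparison of second-order Taylor expansions.  If \<phi> attains its maximum over \<Omega> - U at a
   boundary point, then its gradient there is \<mu> times the inner unit normal of U, \<mu> \<ge> 0, and moving
   along curves in the graph shows D\<^sup>2\<phi> \<le> - \<mu> D\<^sup>2f on the tangent space; the trace over the
   directions of the k largest curvatures bounds P_minus k from above by Ky Fan's principle.
   Conversely, if the sum of the k largest curvatures is negative at p, take in graph coordinates
   (w, t) centred at p the polynomial
     t - (w \<bullet> D\<^sup>2f(0) w + \<epsilon> |w|\<^sup>2) / 2 + c t\<^sup>2 - C |(w, t)|^4.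
   For small \<epsilon> and large c the k smallest eigenvalues of its Hessian at p are tangential and have positive sum,
   and for large C it is nonpositive on all of the complement of U. *)

theory Submission
  imports Defs
begin

section \<open>Spectral theorem for symmetric matrices\<close>

text \<open>A maximiser \<open>x\<close> of the Rayleigh quotient on the unit sphere of
  \<open>S\<close> is an eigenvector: otherwise moving along the defect \<open>T x - l x\<close>,
  which lies in \<open>S\<close> by invariance, would exceed the maximum.\<close>

lemma self_adjoint_eigenvector:
  fixes T :: "'a::euclidean_space \<Rightarrow> 'a"
  assumes lin: "linear T" and adj: "\<And>x y. T x \<bullet> y = x \<bullet> T y"
    and S: "subspace S" "T ` S \<subseteq> S" "S \<noteq> {0}"
  obtains x where "x \<in> S" "norm x = 1" "T x = (x \<bullet> T x) *\<^sub>R x"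
proof -
  let ?K = "S \<inter> sphere 0 1"
  obtain z where z: "z \<in> S" "z \<noteq> 0"
    using S(1,3) subspace_0 by blast
  have "compact ?K"
    using closed_subspace[OF S(1)] by (simp add: closed_Int_compact)
  moreover have "z /\<^sub>R norm z \<in> ?K"
    using z S(1) by (simp add: subspace_scale)
  then have "?K \<noteq> {}" by blast
  moreover have "continuous_on ?K (\<lambda>x. x \<bullet> T x)"
    using lin by (intro continuous_intros linear_continuous_on) (simp add: linear_conv_bounded_linear)
  ultimately obtain x where x: "x \<in> ?K" and max: "\<And>y. y \<in> ?K \<Longrightarrow> y \<bullet> T y \<le> x \<bullet> T x"
    using continuous_attains_sup[of ?K "\<lambda>x. x \<bullet> T x"] by blast
  define l where "l = x \<bullet> T x"
  \<comment> \<open>\<open>q\<close> is nonnegative on \<open>S\<close> and vanishes at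
    \<open>x\<close>, so it can have no first-order decrease there.\<close>
  define q where "q y = l * (y \<bullet> y) - y \<bullet> T y" for y
  have xx: "x \<bullet> x = 1" using x by (simp add: norm_eq_1)
  have q_nonneg: "q y \<ge> 0" if "y \<in> S" for y
  proof (cases "y = 0")
    case False
    have "y /\<^sub>R norm y \<in> ?K"
      using that False S(1) by (simp add: subspace_scale)
    then have "(y /\<^sub>R norm y) \<bullet> T (y /\<^sub>R norm y) \<le> l"
      using max l_def by blast
    then have "(y \<bullet> T y) / (y \<bullet> y) \<le> l"
      using lin by (simp add: linear_cmul dot_square_norm power2_eq_square divide_simps split: if_splits)
    moreover have "y \<bullet> y > 0" using False by simp
    ultimately show ?thesis by (simp add: q_def divide_le_eq)
  qed (simp add: q_def)
  define w where "w = T x - l *\<^sub>R x"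
  have wS: "w \<in> S" using x S(1,2) by (auto simp: w_def intro!: subspace_diff subspace_scale)
  have q_line: "q (x - t *\<^sub>R w) = 2 * t * (w \<bullet> w) + t\<^sup>2 * q w" for t
  proof -
    have "x \<bullet> T w = w \<bullet> T x" using adj[of x w] by (simp add: inner_commute)
    moreover have "w \<bullet> T x = w \<bullet> w + l * (w \<bullet> x)"
      using arg_cong[OF w_def, of "\<lambda>u. w \<bullet> u"] by (simp add: inner_diff_right)
    ultimately show ?thesis
      using lin xx
      by (simp add: q_def linear_diff linear_cmul inner_diff_left inner_diff_right l_def[symmetric]
          power2_eq_square inner_commute algebra_simps)
  qed
  have "w = 0"
  proof (rule ccontr)
    assume "w \<noteq> 0"
    define c where "c = w \<bullet> w"
    have c: "c > 0" using \<open>w \<noteq> 0\<close> by (simp add: c_def)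
    \<comment> \<open>Nearly the minimiser \<open>- c / q w\<close> of the quadratic
      \<open>2 t c + t^2 q w\<close>; the added 1 guards against \<open>q w = 0\<close>.\<close>
    define t where "t = - c / (q w + 1)"
    have qw: "q w \<ge> 0" using q_nonneg wS by blast
    have t: "t < 0" using c qw by (simp add: t_def divide_neg_pos)
    have "x - t *\<^sub>R w \<in> S" using x wS S(1) by (auto intro!: subspace_diff subspace_scale)
    then have "0 \<le> 2 * t * c + t\<^sup>2 * q w"
      using q_nonneg q_line c_def by metis
    also have "\<dots> = t * (2 * c + t * q w)"
      by (simp add: power2_eq_square algebra_simps)
    also have "2 * c + t * q w = c + c / (q w + 1)"
      using qw by (simp add: t_def field_simps)
    also have "t * \<dots> < 0"
      using t c qw by (simp add: mult_neg_pos add_pos_nonneg)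
    finally show False by simp
  qed
  then show ?thesis using that[of x] x by (simp add: w_def l_def)
qed

text \<open>Take an orthonormal set of eigenvectors of largest cardinality. Its orthogonal
  complement is invariant under \<open>T\<close>, so if nonzero it would supply one more
  eigenvector.\<close>

lemma self_adjoint_eigenbasis:
  fixes T :: "'a::euclidean_space \<Rightarrow> 'a"
  assumes lin: "linear T" and adj: "\<And>x y. T x \<bullet> y = x \<bullet> T y"
  obtains B where "pairwise orthogonal B" "\<And>b. b \<in> B \<Longrightarrow> norm b = 1"
    "\<And>b. b \<in> B \<Longrightarrow> T b = (b \<bullet> T b) *\<^sub>R b" "card B = DIM('a)" "finite B"
proof -
  define P where "P B \<longleftrightarrow> pairwise orthogonal B \<and>
    (\<forall>b\<in>B. norm b = 1 \<and> T b = (b \<bullet> T b) *\<^sub>R b)" for B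
  have indep: "independent B" if "P B" for B
    using that by (intro pairwise_orthogonal_independent) (auto simp: P_def)
  have "card B \<le> DIM('a)" if "P B" for B
    using independent_card_le[OF indep[OF that]] .
  moreover have "P {}" by (simp add: P_def)
  ultimately obtain B where B: "P B" and max: "\<And>C. P C \<Longrightarrow> card C \<le> card B"
    using ex_has_greatest_nat[of P "{}" card "Suc DIM('a)"] by (metis le_imp_less_Suc)
  have fin: "finite B" using B pairwise_orthogonal_imp_finite by (auto simp: P_def)
  let ?S = "{y. \<forall>b\<in>B. orthogonal b y}"
  have "?S = {0}"
  proof (rule ccontr)
    assume ne: "?S \<noteq> {0}"
    have inv: "T ` ?S \<subseteq> ?S"
    proof clarify
      fix y b assume y: "\<forall>b\<in>B. orthogonal b y" and b: "b \<in> B"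
      have "b \<bullet> T y = T b \<bullet> y" by (simp add: adj)
      also have "\<dots> = (b \<bullet> T b) * (b \<bullet> y)"
        using B b by (metis P_def inner_scaleR_left)
      finally show "orthogonal b (T y)" using y b by (simp add: orthogonal_def)
    qed
    obtain x where x: "x \<in> ?S" "norm x = 1" "T x = (x \<bullet> T x) *\<^sub>R x"
      by (rule self_adjoint_eigenvector[OF lin adj subspace_orthogonal_to_vectors inv ne])
    have "x \<notin> B"
      using x by (auto simp: orthogonal_self)
    moreover have "P (insert x B)"
      using B x by (auto simp: P_def pairwise_insert orthogonal_commute)
    ultimately show False using max[of "insert x B"] fin by simp
  qed
  have "span B = UNIV"
  proof (rule ccontr)
    assume "span B \<noteq> UNIV"
    then obtain a where a: "a \<noteq> 0" "\<And>x. x \<in> span B \<Longrightarrow> a \<bullet> x = 0"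
      using span_not_UNIV_orthogonal by blast
    then have "a \<in> ?S"
      by (simp add: orthogonal_def inner_commute span_base)
    then show False using a(1) \<open>?S = {0}\<close> by blast
  qed
  then have "card B = DIM('a)"
    using indep[OF B] dim_eq_card[of B UNIV] by (simp add: dim_UNIV)
  then show ?thesis using that[of B] B fin by (auto simp: P_def)
qed

text \<open>Indexed families instead of sets: traces become sums over \<open>I\<close>, and
  distinctness of the vectors is built in.\<close>

definition orthonormal_on :: "'i set \<Rightarrow> ('i \<Rightarrow> 'a::real_inner) \<Rightarrow> bool" where
  "orthonormal_on I v \<longleftrightarrow> (\<forall>i\<in>I. \<forall>j\<in>I. v i \<bullet> v j = (if i = j then 1 else 0))"

lemma orthonormal_onD:
  "orthonormal_on I v \<Longrightarrow> i \<in> I \<Longrightarrow> j \<in> I \<Longrightarrow> v i \<bullet> v j = (if i = j then 1 else 0)"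
  by (simp add: orthonormal_on_def)

lemma orthonormal_on_imp:
  assumes "orthonormal_on I v"
  shows "pairwise orthogonal (v ` I)" "inj_on v I" "\<And>b. b \<in> v ` I \<Longrightarrow> norm b = 1"
proof -
  show "pairwise orthogonal (v ` I)"
    using assms by (force simp: orthonormal_on_def pairwise_def orthogonal_def)
  show "inj_on v I"
    using assms by (metis orthonormal_on_def inj_onI zero_neq_one)
  show "\<And>b. b \<in> v ` I \<Longrightarrow> norm b = 1"
    using assms by (auto simp: orthonormal_on_def norm_eq_1)
qed

text \<open>The matrix \<open>Q\<close> with columns \<open>v j\<close> satisfies
  \<open>A ** Q = Q ** D\<close> with \<open>D\<close> diagonal. Read over the polynomial ring, this
  relates \<open>X - A\<close> to \<open>X - D\<close>, and the nonzero determinant of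
  \<open>Q\<close> cancels.\<close>

lemma charpoly_eq_prod_eigenbasis:
  fixes A :: "real^'n^'n" and v :: "'n \<Rightarrow> real^'n"
  assumes on: "orthonormal_on UNIV v"
    and ev: "\<And>i. A *v v i = \<mu> i *\<^sub>R v i"
  shows "charpoly A = (\<Prod>i\<in>UNIV. [:- \<mu> i, 1:])"
proof -
  define Q :: "real^'n^'n" where "Q = (\<chi> i j. v j $ i)"
  define D :: "real^'n^'n" where "D = (\<chi> i j. if i = j then \<mu> i else 0)"
  let ?P = "map_matrix (\<lambda>a::real. [:a:]) :: real^'n^'n \<Rightarrow> (real poly)^'n^'n"
  let ?X = "mat [:0, 1:] :: (real poly)^'n^'n"
  have const_sum: "[:\<Sum>k\<in>K. f k:] = (\<Sum>k\<in>K. [:f k:])" for f :: "'n \<Rightarrow> real" and K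
  proof (induction K rule: infinite_finite_induct)
    case (insert x K)
    have "[:f x + (\<Sum>k\<in>K. f k):] = [:f x:] + [:\<Sum>k\<in>K. f k:]" by simp
    then show ?case using insert by simp
  qed auto
  have P_mult: "?P (M ** N) = ?P M ** ?P N" for M N
    by (simp add: vec_eq_iff matrix_matrix_mult_def const_sum mult.commute)
  have "transpose Q ** Q = mat 1"
    using on by (simp add: orthonormal_on_def vec_eq_iff matrix_matrix_mult_def Q_def transpose_def
        mat_def inner_vec_def)
  then have "?P (transpose Q) ** ?P Q = ?P (mat 1)"
    by (simp flip: P_mult)
  also have "\<dots> = mat 1"
    by (simp add: vec_eq_iff mat_def one_pCons)
  finally have "det (?P (transpose Q)) * det (?P Q) = 1"
    by (metis det_mul det_I)
  then have det_Q: "det (?P Q) \<noteq> 0" by auto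
  have "A ** Q = Q ** D"
  proof -
    have "(A *v v j) $ i = \<mu> j * v j $ i" for i j by (simp add: ev)
    then show ?thesis
      by (simp add: vec_eq_iff matrix_matrix_mult_def matrix_vector_mult_def Q_def D_def
          if_distrib cong: if_cong)
  qed
  then have "?P A ** ?P Q = ?P Q ** ?P D"
    by (simp flip: P_mult)
  moreover have "?X ** ?P Q = ?P Q ** ?X"
    by (simp add: vec_eq_iff matrix_matrix_mult_def mat_def if_distrib if_distribR mult.commute cong: if_cong)
  moreover have "(M - N) ** R = M ** R - N ** R" "R ** (M - N) = R ** M - R ** N"
    for M N R :: "(real poly)^'n^'n"
    by (simp_all add: vec_eq_iff matrix_matrix_mult_def left_diff_distrib right_diff_distrib sum_subtractf)
  ultimately have "(?X - ?P A) ** ?P Q = ?P Q ** (?X - ?P D)"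
    by metis
  then have "det (?X - ?P A) * det (?P Q) = det (?P Q) * det (?X - ?P D)"
    by (metis det_mul)
  then have "charpoly A = det (?X - ?P D)"
    using det_Q by (simp add: charpoly_def mult.commute)
  also have "\<dots> = (\<Prod>i\<in>UNIV. (?X - ?P D) $ i $ i)"
    by (rule det_diagonal) (simp add: mat_def D_def)
  also have "\<dots> = (\<Prod>i\<in>UNIV. [:- \<mu> i, 1:])"
    by (simp add: mat_def D_def)
  finally show ?thesis .
qed

lemma symmetric_matrix_inner:
  fixes A :: "real^'n^'n"
  assumes "transpose A = A"
  shows "(A *v x) \<bullet> y = x \<bullet> (A *v y)"
  by (metis assms dot_lmul_matrix transpose_matrix_vector)

lemma symmetric_matrixI:
  fixes A :: "real^'n^'n"
  assumes "\<And>x y. x \<bullet> (A *v y) = y \<bullet> (A *v x)"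
  shows "transpose A = A"
proof -
  have "A $ i $ j = axis i 1 \<bullet> (A *v axis j 1)" for i j
    by (simp add: matrix_vector_mult_basis column_def inner_axis')
  then show ?thesis using assms by (simp add: transpose_def vec_eq_iff)
qed

text \<open>This ties \<open>eigenvalue\<close>, defined through roots of the characteristic
  polynomial, to actual eigenvectors: an eigenbasis is enumerated in the order of its
  eigenvalues.\<close>

theorem symmetric_matrix_spectral:
  fixes A :: "real^'n^'n"
  assumes "transpose A = A"
  obtains e where "orthonormal_on {1..CARD('n)} e"
    "\<forall>i\<in>{1..CARD('n)}. A *v e i = eigenvalue A i *\<^sub>R e i"
    "mono_on {1..CARD('n)} (eigenvalue A)"
proof -
  obtain B where B: "pairwise orthogonal B" "\<And>b. b \<in> B \<Longrightarrow> norm b = 1"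
    "\<And>b. b \<in> B \<Longrightarrow> A *v b = (b \<bullet> (A *v b)) *\<^sub>R b" "card B = CARD('n)" "finite B"
    using self_adjoint_eigenbasis[OF matrix_vector_mul_linear[of A] symmetric_matrix_inner[OF assms]]
    by auto
  obtain v where v: "bij_betw v (UNIV::'n set) B"
    using B(4,5) by (metis finite_class.finite_UNIV finite_same_card_bij)
  have vB: "v i \<in> B" for i using v by (auto simp: bij_betw_def)
  have on': "v i \<bullet> v j = (if i = j then 1 else 0)" for i j
  proof (cases "i = j")
    case False
    then have "v i \<noteq> v j" using v by (auto simp: bij_betw_def inj_on_def)
    then show ?thesis using B(1) vB False by (auto simp: pairwise_def orthogonal_def)
  qed (use B(2) vB in \<open>auto simp: norm_eq_1\<close>)
  then have on: "orthonormal_on UNIV v" by (simp add: orthonormal_on_def)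
  define \<mu> where "\<mu> i = v i \<bullet> (A *v v i)" for i
  have ev: "A *v v i = \<mu> i *\<^sub>R v i" for i
    using B(3) vB by (auto simp: \<mu>_def)
  obtain xs :: "'n list" where xs: "set xs = UNIV" "distinct xs"
    using finite_distinct_list[OF finite_class.finite_UNIV] by blast
  \<comment> \<open>Sorting the index type by eigenvalue makes \<open>map \<mu> ys\<close> the
    sorted list of roots, since the characteristic polynomial splits into the factors
    \<open>[:- \<mu> i, 1:]\<close>.\<close>
  define ys where "ys = sort_key \<mu> xs"
  have ys: "set ys = UNIV" "distinct ys" "sorted (map \<mu> ys)"
    using xs by (auto simp: ys_def)
  have len: "length ys = CARD('n)"
    using ys by (metis distinct_card)
  have "proots (charpoly A) = (\<Sum>i\<in>UNIV. proots [:- \<mu> i, 1:])"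
    unfolding charpoly_eq_prod_eigenbasis[OF on ev] by (rule proots_prod) auto
  also have "\<dots> = (\<Sum>i\<in>UNIV. {#\<mu> i#})" by simp
  also have "\<dots> = mset (map \<mu> ys)"
    unfolding ys(1)[symmetric] using ys(2) by (induction ys) auto
  finally have "sorted_list_of_multiset (proots (charpoly A)) = map \<mu> ys"
    using ys(3) by (simp add: sorted_sort_id del: mset_map)
  then have eig: "eigenvalue A i = \<mu> (ys ! (i - 1))" if "i \<in> {1..CARD('n)}" for i
  proof -
    have "i - 1 < length ys" using that len by auto
    then show ?thesis by (simp add: eigenvalue_def \<open>_ = map \<mu> ys\<close>)
  qed
  \<comment> \<open>Eigenvalues are numbered from 1 but list positions from 0, hence
    \<open>i - 1\<close>.\<close>
  show ?thesis
  proof (rule that[of "\<lambda>i. v (ys ! (i - 1))"])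
    show "orthonormal_on {1..CARD('n)} (\<lambda>i. v (ys ! (i - 1)))"
      unfolding orthonormal_on_def
    proof (intro ballI)
      fix i j assume "i \<in> {1..CARD('n)}" "j \<in> {1..CARD('n)}"
      then have "i - 1 < length ys" "j - 1 < length ys" "i - 1 = j - 1 \<longleftrightarrow> i = j"
        using len by auto
      then show "v (ys ! (i - 1)) \<bullet> v (ys ! (j - 1)) = (if i = j then 1 else 0)"
        using ys(2) by (simp add: on' nth_eq_iff_index_eq)
    qed
    show "\<forall>i\<in>{1..CARD('n)}. A *v v (ys ! (i - 1)) = eigenvalue A i *\<^sub>R v (ys ! (i - 1))"
      using eig ev by simp
    show "mono_on {1..CARD('n)} (eigenvalue A)"
    proof (rule mono_onI)
      fix i j assume "i \<in> {1..CARD('n)}" "j \<in> {1..CARD('n)}" "i \<le> j"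
      moreover from this have "i - 1 \<le> j - 1" "i - 1 < length ys" "j - 1 < length ys"
        using len by auto
      ultimately show "eigenvalue A i \<le> eigenvalue A j"
        using eig sorted_nth_mono[OF ys(3), of "i - 1" "j - 1"] by simp
    qed
  qed
qed

section \<open>Ky Fan's principle and \<open>P_minus\<close> as a minimal trace\<close>

text \<open>
  Expanding each \<open>v i\<close> in the eigenbasis gives a combination of the \<open>\<mu> j\<close> with weights
  \<open>s j = (\<Sum>i. (v i \<bullet> e j)\<^sup>2) \<in> [0, 1]\<close> of total mass \<open>card K\<close>; it is least when the mass sits on \<open>K\<close>.
\<close>

lemma Ky_Fan_lower_bound:
  fixes T :: "'a::euclidean_space \<Rightarrow> 'a" and v :: "'i \<Rightarrow> 'a" and e :: "'j \<Rightarrow> 'a"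
  assumes lin: "linear T"
    and fin: "finite I" "finite J" and K: "K \<subseteq> J" "card K = card I"
    and v: "orthonormal_on I v" and e: "orthonormal_on J e"
    and J: "card J = DIM('a)"
    and ev: "\<And>j. j \<in> J \<Longrightarrow> T (e j) = \<mu> j *\<^sub>R e j"
    and low: "\<And>i. i \<in> K \<Longrightarrow> \<mu> i \<le> c" and high: "\<And>j. j \<in> J - K \<Longrightarrow> c \<le> \<mu> j"
  shows "(\<Sum>j\<in>K. \<mu> j) \<le> (\<Sum>i\<in>I. v i \<bullet> T (v i))"
proof -
  have finK: "finite K" using K fin finite_subset by blast
  note v = orthonormal_onD[OF v] and eo = orthonormal_on_imp[OF e] and e = orthonormal_onD[OF e]
  have "independent (e ` J)"
    using eo by (intro pairwise_orthogonal_independent) (metis, metis norm_zero zero_neq_one)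
  then have span: "span (e ` J) = UNIV"
    using J eo(2) fin(2) card_eq_dim[of "e ` J" UNIV] by (auto simp: card_image dim_UNIV)
  have expand: "x = (\<Sum>j\<in>J. (x \<bullet> e j) *\<^sub>R e j)" for x
    using orthonormal_basis_expand[OF eo(1) eo(3), of x] span fin(2)
    by (simp add: sum.reindex[OF eo(2)])
  have quad: "x \<bullet> T x = (\<Sum>j\<in>J. \<mu> j * (x \<bullet> e j)\<^sup>2)" for x
  proof -
    have "T x = (\<Sum>j\<in>J. (x \<bullet> e j) *\<^sub>R (\<mu> j *\<^sub>R e j))"
      using lin ev by (subst expand[of x]) (simp add: linear_sum linear_cmul)
    then show ?thesis
      by (simp add: inner_sum_right power2_eq_square mult_ac)
  qed
  have parseval: "x \<bullet> x = (\<Sum>j\<in>J. (x \<bullet> e j)\<^sup>2)" for x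
  proof -
    have "x \<bullet> x = x \<bullet> (\<Sum>j\<in>J. (x \<bullet> e j) *\<^sub>R e j)"
      using expand[of x] by simp
    then show ?thesis by (simp add: inner_sum_right power2_eq_square)
  qed
  have bessel: "(\<Sum>i\<in>I. (v i \<bullet> x)\<^sup>2) \<le> x \<bullet> x" for x
  proof -
    \<comment> \<open>\<open>y\<close> is the orthogonal projection of \<open>x\<close> onto the
      span of the \<open>v i\<close>; Bessel's inequality is
      \<open>|x - y|^2 \<ge> 0\<close>.\<close>
    define y where "y = (\<Sum>i\<in>I. (v i \<bullet> x) *\<^sub>R v i)"
    have "x \<bullet> y = (\<Sum>i\<in>I. (v i \<bullet> x)\<^sup>2)"
      by (simp add: y_def inner_sum_right power2_eq_square inner_commute)
    moreover have "v i \<bullet> y = v i \<bullet> x" if "i \<in> I" for i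
    proof -
      have "v i \<bullet> y = (\<Sum>j\<in>I. (v j \<bullet> x) * (if i = j then 1 else 0))"
        using that v by (simp add: y_def inner_sum_right)
      then show ?thesis using that fin(1) by (simp add: if_distrib cong: if_cong)
    qed
    then have "y \<bullet> y = (\<Sum>i\<in>I. (v i \<bullet> x)\<^sup>2)"
      by (subst (1) y_def) (simp add: inner_sum_left power2_eq_square)
    moreover have "0 \<le> (x - y) \<bullet> (x - y)" by simp
    ultimately show ?thesis
      by (simp add: inner_diff_left inner_diff_right inner_commute)
  qed
  define s where "s j = (\<Sum>i\<in>I. (v i \<bullet> e j)\<^sup>2)" for j
  have s: "0 \<le> s j" "j \<in> J \<Longrightarrow> s j \<le> 1" for j
    using bessel[of "e j"] e by (auto simp: s_def sum_nonneg)
  have mass: "(\<Sum>j\<in>J. s j) = card K"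
  proof -
    have "(\<Sum>j\<in>J. s j) = (\<Sum>i\<in>I. v i \<bullet> v i)"
      unfolding s_def parseval by (rule sum.swap)
    then show ?thesis using v K(2) by simp
  qed
  have "(\<Sum>i\<in>I. v i \<bullet> T (v i)) = (\<Sum>j\<in>J. \<mu> j * s j)"
    unfolding quad s_def sum_distrib_left by (rule sum.swap)
  \<comment> \<open>Both the weights \<open>s\<close> and the indicator of \<open>K\<close> have
    total mass \<open>card K\<close>, so every \<open>\<mu> j\<close> may be shifted by
    \<open>c\<close> in their difference.\<close>
  also have "\<dots> = (\<Sum>j\<in>K. \<mu> j) + (\<Sum>j\<in>J. (\<mu> j - c) * (s j - (if j \<in> K then 1 else 0)))"
  proof -
    have "(\<Sum>j\<in>J. (\<mu> j - c) * (s j - (if j \<in> K then 1 else 0)))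
        = (\<Sum>j\<in>J. \<mu> j * s j) - (\<Sum>j\<in>J. if j \<in> K then \<mu> j else 0)
          - c * ((\<Sum>j\<in>J. s j) - (\<Sum>j\<in>J. if j \<in> K then 1 else 0))"
      unfolding sum_subtractf[symmetric] sum_distrib_left
      by (rule sum.cong) (auto simp: algebra_simps)
    also have "(\<Sum>j\<in>J. if j \<in> K then \<mu> j else 0) = (\<Sum>j\<in>K. \<mu> j)"
      using K(1) fin(2) by (simp add: sum.inter_restrict[symmetric] Int_absorb1)
    also have "(\<Sum>j\<in>J. if j \<in> K then 1 else (0::real)) = card K"
      using K(1) fin(2) by (simp add: sum.inter_restrict[symmetric] Int_absorb1)
    finally show ?thesis by (simp add: mass)
  qed
  finally have "(\<Sum>i\<in>I. v i \<bullet> T (v i))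
      = (\<Sum>j\<in>K. \<mu> j) + (\<Sum>j\<in>J. (\<mu> j - c) * (s j - (if j \<in> K then 1 else 0)))" .
  \<comment> \<open>The two factors have the same sign: both are nonpositive on \<open>K\<close> and
    nonnegative off it.\<close>
  moreover have "(\<Sum>j\<in>J. (\<mu> j - c) * (s j - (if j \<in> K then 1 else 0))) \<ge> 0"
  proof (rule sum_nonneg)
    fix j assume "j \<in> J"
    then show "0 \<le> (\<mu> j - c) * (s j - (if j \<in> K then 1 else 0))"
      using s[of j] low[of j] high[of j] by (auto intro: mult_nonneg_nonneg mult_nonpos_nonpos)
  qed
  ultimately show ?thesis by simp
qed

text \<open>Ky Fan's bound for the eigenbasis of \<open>A\<close>, with the first \<open>k\<close>
  indices as \<open>K\<close> and the \<open>k\<close>-th eigenvalue as threshold.\<close>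

lemma P_minus_le_trace:
  fixes A :: "real^'n^'n" and v :: "'i \<Rightarrow> real^'n"
  assumes A: "transpose A = A" and k: "1 \<le> k" "k \<le> CARD('n)" and I: "finite I" "card I = k"
    and v: "orthonormal_on I v"
  shows "P_minus k A \<le> (\<Sum>i\<in>I. v i \<bullet> (A *v v i))"
proof -
  obtain e where e: "orthonormal_on {1..CARD('n)} e"
    "\<forall>i\<in>{1..CARD('n)}. A *v e i = eigenvalue A i *\<^sub>R e i"
    "mono_on {1..CARD('n)} (eigenvalue A)"
    by (rule symmetric_matrix_spectral[OF A])
  show ?thesis
    unfolding P_minus_def
  proof (rule Ky_Fan_lower_bound[where J = "{1..CARD('n)}" and e = e and c = "eigenvalue A k"])
    show "A *v e j = eigenvalue A j *\<^sub>R e j" if "j \<in> {1..CARD('n)}" for j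
      using e(2) that by blast
    show "eigenvalue A i \<le> eigenvalue A k" if "i \<in> {1..k}" for i
      using mono_onD[OF e(3), of i k] that k by simp
    show "eigenvalue A k \<le> eigenvalue A j" if "j \<in> {1..CARD('n)} - {1..k}" for j
      using mono_onD[OF e(3), of k j] that k by auto
  qed (use k I v e in auto)
qed

text \<open>The minimum in Ky Fan's principle is attained at eigenvectors of the \<open>k\<close>
  smallest eigenvalues.\<close>

lemma P_minus_eq_trace:
  fixes A :: "real^'n^'n"
  assumes A: "transpose A = A" and k: "k \<le> CARD('n)"
  obtains v where "orthonormal_on {1..k} v" "P_minus k A = (\<Sum>i=1..k. v i \<bullet> (A *v v i))"
proof -
  obtain e where e: "orthonormal_on {1..CARD('n)} e"
    "\<forall>i\<in>{1..CARD('n)}. A *v e i = eigenvalue A i *\<^sub>R e i"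
    "mono_on {1..CARD('n)} (eigenvalue A)"
    by (rule symmetric_matrix_spectral[OF A])
  show ?thesis
    by (rule that[of e]) (use e k in \<open>auto simp: P_minus_def orthonormal_on_def\<close>)
qed

section \<open>Gradient, Hessian and second-order Taylor expansion\<close>

lemma has_derivative_gradient:
  fixes f :: "real^'n \<Rightarrow> real"
  assumes "f differentiable (at x)"
  shows "(f has_derivative (\<lambda>v. gradient f x \<bullet> v)) (at x)"
proof -
  let ?D = "frechet_derivative f (at x)"
  have D: "(f has_derivative ?D) (at x)"
    using assms by (simp add: frechet_derivative_works)
  then have lin: "linear ?D" by (rule has_derivative_linear)
  have "?D = (\<lambda>v. gradient f x \<bullet> v)"
  proof
    fix v
    have "?D v = ?D (\<Sum>i\<in>UNIV. v $ i *\<^sub>R axis i 1)"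
      using basis_expansion[of v] by (simp add: scalar_mult_eq_scaleR)
    then show "?D v = gradient f x \<bullet> v"
      using lin by (simp add: linear_sum linear_cmul gradient_def inner_vec_def mult.commute)
  qed
  then show ?thesis using D by simp
qed

lemma gradient_eqI:
  assumes "(f has_derivative (\<lambda>v. g \<bullet> v)) (at x)"
  shows "gradient f x = g"
  by (simp add: gradient_def vec_eq_iff inner_axis frechet_derivative_at[OF assms, symmetric])

lemma hessian_eqI:
  assumes "(gradient f has_derivative (\<lambda>v. A *v v)) (at x)"
  shows "hessian f x = A"
  using frechet_derivative_at[OF assms, symmetric] by (simp add: hessian_def jacobian_def)

lemma C2_onD:
  assumes "C2_on S f" "x \<in> S"
  shows "(f has_derivative (\<lambda>v. gradient f x \<bullet> v)) (at x)"
    "(gradient f has_derivative (\<lambda>v. hessian f x *v v)) (at x)"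
  using assms by (auto simp: C2_on_def hessian_def has_derivative_gradient jacobian_works[symmetric])

text \<open>The error of a second-order expansion at \<open>x\<close> with linear part
  \<open>a\<close> and quadratic part \<open>G\<close>. Symmetry of \<open>G\<close> is not
  presupposed, because symmetry of the Hessian is itself deduced from estimates of this
  remainder.\<close>

definition taylor_remainder ::
    "(real^'n \<Rightarrow> real) \<Rightarrow> real^'n \<Rightarrow> real^'n \<Rightarrow> real^'n^'n \<Rightarrow> real^'n \<Rightarrow> real" where
  "taylor_remainder f x a G y = f (x + y) - f x - a \<bullet> y - (y \<bullet> (G *v y)) / 2"

text \<open>The mean value theorem on the segment from \<open>a\<close> to \<open>a + b\<close>. As
  \<open>G\<close> may be asymmetric, the derivative of its quadratic form keeps both mixed
  terms.\<close>

lemma taylor_remainder_increment: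
  fixes f :: "real^'n \<Rightarrow> real"
  assumes der: "\<And>y. y \<in> ball x d \<Longrightarrow> (f has_derivative (\<lambda>v. g y \<bullet> v)) (at y)"
    and ab: "norm a < d" "norm (a + b) < d"
  obtains t where "0 < t" "t < 1"
    "taylor_remainder f x c G (a + b) - taylor_remainder f x c G a
      = (g (x + (a + t *\<^sub>R b)) - c) \<bullet> b
        - (b \<bullet> (G *v (a + t *\<^sub>R b)) + (a + t *\<^sub>R b) \<bullet> (G *v b)) / 2"
proof -
  let ?y = "\<lambda>t. a + t *\<^sub>R b"
  let ?h = "\<lambda>t. taylor_remainder f x c G (?y t)"
  let ?h' = "\<lambda>t. (g (x + ?y t) - c) \<bullet> b - (b \<bullet> (G *v ?y t) + ?y t \<bullet> (G *v b)) / 2"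
  have "\<exists>t>0. t < 1 \<and> ?h 1 - ?h 0 = (1 - 0) * ?h' t"
  proof (rule MVT2)
    fix t :: real assume t: "0 \<le> t" "t \<le> 1"
    have "?y t = (1 - t) *\<^sub>R a + t *\<^sub>R (a + b)" by (simp add: algebra_simps)
    moreover have "\<dots> \<in> ball 0 d"
      using ab t by (intro convexD[OF convex_ball]) auto
    ultimately have "(f has_derivative (\<lambda>v. g (x + ?y t) \<bullet> v)) (at (x + ?y t))"
      by (intro der) (simp add: dist_norm norm_minus_commute)
    moreover have "((\<lambda>t. x + ?y t) has_derivative (\<lambda>s. s *\<^sub>R b)) (at t)"
      by (auto intro!: derivative_eq_intros)
    ultimately have "((\<lambda>t. f (x + ?y t)) has_derivative (\<lambda>s. g (x + ?y t) \<bullet> (s *\<^sub>R b))) (at t)"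
      by (rule has_derivative_compose[rotated])
    moreover have "((\<lambda>t. G *v ?y t) has_derivative (\<lambda>s. G *v (s *\<^sub>R b))) (at t)"
      by (intro bounded_linear.has_derivative[OF matrix_vector_mul_bounded_linear])
        (auto intro!: derivative_eq_intros)
    ultimately have "(?h has_derivative (\<lambda>s. g (x + ?y t) \<bullet> (s *\<^sub>R b) - c \<bullet> (s *\<^sub>R b)
        - (?y t \<bullet> (G *v (s *\<^sub>R b)) + (s *\<^sub>R b) \<bullet> (G *v ?y t)) / 2)) (at t)"
      unfolding taylor_remainder_def by (auto intro!: derivative_eq_intros)
    then show "(?h has_real_derivative ?h' t) (at t)"
      unfolding has_field_derivative_def
      by (rule has_derivative_eq_rhs)
        (simp add: fun_eq_iff inner_diff_left matrix_vector_mult_scaleR algebra_simps)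
  qed simp
  then show ?thesis using that by auto
qed

text \<open>On the segment from 0 to \<open>y\<close> the increment of the remainder is the
  first-order error of the gradient, paired with \<open>y\<close>; differentiability of the gradient
  at \<open>x\<close> makes it small.\<close>

lemma taylor_remainder_bound:
  fixes f :: "real^'n \<Rightarrow> real"
  assumes "open S" "x \<in> S" "C2_on S f" "0 < e"
  obtains d where "0 < d" "ball x d \<subseteq> S"
    "\<And>y. norm y < d \<Longrightarrow> norm (gradient f (x + y) - gradient f x - hessian f x *v y) \<le> e * norm y"
    "\<And>y. norm y < d \<Longrightarrow>
       \<bar>taylor_remainder f x (gradient f x) (hessian f x) y\<bar> \<le> e * (norm y)\<^sup>2"
proof -
  let ?g = "gradient f" and ?G = "hessian f x"
  obtain d1 where d1: "d1 > 0" "ball x d1 \<subseteq> S"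
    using assms by (meson open_contains_ball)
  have "(?g has_derivative (\<lambda>v. ?G *v v)) (at x)"
    using C2_onD assms by blast
  then obtain d2 where d2: "d2 > 0"
    "\<And>y. norm (y - x) < d2 \<Longrightarrow> norm (?g y - ?g x - ?G *v (y - x)) \<le> e * norm (y - x)"
    using \<open>0 < e\<close> unfolding has_derivative_at_alt by blast
  define d where "d = min d1 d2"
  have d: "0 < d" "ball x d \<subseteq> S" using d1 d2 by (auto simp: d_def)
  have g: "norm (?g (x + y) - ?g x - ?G *v y) \<le> e * norm y" if "norm y < d" for y
    using d2(2)[of "x + y"] that by (simp add: d_def)
  have "\<bar>taylor_remainder f x (?g x) ?G y\<bar> \<le> e * (norm y)\<^sup>2" if y: "norm y < d" for y
  proof -
    obtain t where t: "0 < t" "t < 1"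
      "taylor_remainder f x (?g x) ?G (0 + y) - taylor_remainder f x (?g x) ?G 0
        = (?g (x + (0 + t *\<^sub>R y)) - ?g x) \<bullet> y
          - (y \<bullet> (?G *v (0 + t *\<^sub>R y)) + (0 + t *\<^sub>R y) \<bullet> (?G *v y)) / 2"
      by (rule taylor_remainder_increment[of x d f ?g 0 y "?g x" ?G])
        (use d C2_onD[OF assms(3)] y in auto)
    then have "taylor_remainder f x (?g x) ?G y
        = (?g (x + t *\<^sub>R y) - ?g x - ?G *v (t *\<^sub>R y)) \<bullet> y"
      by (simp add: taylor_remainder_def matrix_vector_mult_scaleR inner_diff_left inner_diff_right
          inner_commute)
    also have "\<bar>\<dots>\<bar> \<le> norm (?g (x + t *\<^sub>R y) - ?g x - ?G *v (t *\<^sub>R y)) * norm y"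
      by (rule Cauchy_Schwarz_ineq2)
    also have "norm (?g (x + t *\<^sub>R y) - ?g x - ?G *v (t *\<^sub>R y)) \<le> e * norm (t *\<^sub>R y)"
    proof (rule g)
      have "norm (t *\<^sub>R y) \<le> norm y" using t by (simp add: mult_left_le_one_le)
      then show "norm (t *\<^sub>R y) < d" using y by simp
    qed
    also have "\<dots> \<le> e * norm y" using t \<open>0 < e\<close> by (simp add: mult_left_le_one_le)
    finally show ?thesis by (simp add: power2_eq_square mult_right_mono mult.assoc)
  qed
  then show ?thesis using that d g by blast
qed

text \<open>
  The increment of the remainder over \<open>s v\<close> at \<open>s u\<close> equals
  \<open>s\<^sup>2 (v \<bullet> G u - u \<bullet> G v) / 2\<close> up to \<open>o(s\<^sup>2)\<close>, and the remainder itself is \<open>o(s\<^sup>2)\<close>.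
\<close>

lemma hessian_symmetric:
  fixes f :: "real^'n \<Rightarrow> real"
  assumes "open S" "x \<in> S" "C2_on S f"
  shows "transpose (hessian f x) = hessian f x"
proof -
  let ?g = "gradient f" and ?G = "hessian f x"
  have "v \<bullet> (?G *v u) - u \<bullet> (?G *v v) = 0" (is "?c = 0") for u v
  proof -
    define L where "L = norm u + norm v"
    have "\<bar>?c\<bar> \<le> 0 + e" if "0 < e" for e
    proof -
      \<comment> \<open>Three errors of size \<open>e' (s L)^2\<close> will bound
        \<open>s^2 |?c| / 2\<close>, so \<open>6 L^2 e' \<le> e\<close> is wanted; the added 1 keeps
        the denominator positive when \<open>L = 0\<close>.\<close>
      define e' where "e' = e / (6 * L\<^sup>2 + 1)"
      have e': "0 < e'" using that by (simp add: e'_def add_nonneg_pos)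
      obtain d where d: "0 < d" "ball x d \<subseteq> S"
        "\<And>y. norm y < d \<Longrightarrow> norm (?g (x + y) - ?g x - ?G *v y) \<le> e' * norm y"
        "\<And>y. norm y < d \<Longrightarrow> \<bar>taylor_remainder f x (?g x) ?G y\<bar> \<le> e' * (norm y)\<^sup>2"
        using taylor_remainder_bound[OF assms e'] by blast
      \<comment> \<open>All estimates scale with \<open>s^2\<close>, so one fixed \<open>s\<close>
        with \<open>s L < d\<close> suffices and no limit in \<open>s\<close> is taken.\<close>
      define s where "s = d / (L + 1)"
      have L: "0 \<le> L" by (simp add: L_def)
      have s: "0 < s" "s * L < d"
        using d(1) L by (auto simp: s_def field_simps)
      have small: "norm (s *\<^sub>R u + (t * s) *\<^sub>R v) \<le> s * L" if "0 \<le> t" "t \<le> 1" for t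
      proof -
        have "norm (s *\<^sub>R u + (t * s) *\<^sub>R v) \<le> s * norm u + (t * s) * norm v"
          using that s(1) by (intro order_trans[OF norm_triangle_ineq]) simp
        also have "(t * s) * norm v \<le> s * norm v"
          using that s(1) by (intro mult_right_mono) (auto simp: mult_left_le_one_le)
        finally show ?thesis by (simp add: L_def distrib_left)
      qed
      let ?R = "taylor_remainder f x (?g x) ?G"
      let ?y = "\<lambda>t. s *\<^sub>R u + t *\<^sub>R (s *\<^sub>R v)"
      obtain t where t: "0 < t" "t < 1" "?R (s *\<^sub>R u + s *\<^sub>R v) - ?R (s *\<^sub>R u)
          = (?g (x + ?y t) - ?g x) \<bullet> (s *\<^sub>R v)
            - ((s *\<^sub>R v) \<bullet> (?G *v ?y t) + ?y t \<bullet> (?G *v (s *\<^sub>R v))) / 2"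
        by (rule taylor_remainder_increment[of x d f ?g "s *\<^sub>R u" "s *\<^sub>R v" "?g x" ?G])
          (use d C2_onD[OF assms(3)] small[of 0] small[of 1] s in \<open>auto simp del: norm_scaleR\<close>)
      let ?E = "?g (x + ?y t) - ?g x - ?G *v ?y t"
      \<comment> \<open>The contributions of the intermediate parameter \<open>t\<close> are
        multiples of \<open>v \<bullet> (?G *v v)\<close> and cancel.\<close>
      have "s\<^sup>2 * ?c / 2 = ?R (s *\<^sub>R u + s *\<^sub>R v) - ?R (s *\<^sub>R u) - ?E \<bullet> (s *\<^sub>R v)"
        unfolding t(3)
        by (simp add: matrix_vector_mult_scaleR matrix_vector_right_distrib inner_diff_left
            inner_diff_right inner_commute
            inner_add_left inner_add_right power2_eq_square field_simps)
      moreover have "\<bar>?R (s *\<^sub>R u + s *\<^sub>R v)\<bar> \<le> e' * (s * L)\<^sup>2"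
      proof -
        have "\<bar>?R (s *\<^sub>R u + s *\<^sub>R v)\<bar> \<le> e' * (norm (s *\<^sub>R u + s *\<^sub>R v))\<^sup>2"
          using small[of 1] s by (intro d(4)) simp
        also have "\<dots> \<le> e' * (s * L)\<^sup>2"
          using small[of 1] e' by (intro mult_left_mono power_mono) auto
        finally show ?thesis .
      qed
      moreover have "\<bar>?R (s *\<^sub>R u)\<bar> \<le> e' * (s * L)\<^sup>2"
      proof -
        have "\<bar>?R (s *\<^sub>R u)\<bar> \<le> e' * (norm (s *\<^sub>R u))\<^sup>2"
          using small[of 0] s by (intro d(4)) (simp del: norm_scaleR)
        also have "\<dots> \<le> e' * (s * L)\<^sup>2"
          using small[of 0] e' by (intro mult_left_mono power_mono) auto
        finally show ?thesis .
      qed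
      moreover have "\<bar>?E \<bullet> (s *\<^sub>R v)\<bar> \<le> e' * (s * L)\<^sup>2"
      proof -
        have "\<bar>?E \<bullet> (s *\<^sub>R v)\<bar> \<le> norm ?E * norm (s *\<^sub>R v)"
          by (rule Cauchy_Schwarz_ineq2)
        also have "\<dots> \<le> (e' * (s * L)) * (s * L)"
        proof (intro mult_mono)
          have "norm ?E \<le> e' * norm (?y t)"
            using small[of t] t s by (intro d(3)) simp
          also have "\<dots> \<le> e' * (s * L)" using small[of t] t e' by simp
          finally show "norm ?E \<le> e' * (s * L)" .
          show "norm (s *\<^sub>R v) \<le> s * L" using s by (simp add: L_def)
        qed (use e' s L in auto)
        finally show ?thesis by (simp add: power2_eq_square mult.assoc)
      qed
      ultimately have "\<bar>s\<^sup>2 * ?c / 2\<bar> \<le> 3 * (e' * (s * L)\<^sup>2)" by linarith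
      then have "s\<^sup>2 * \<bar>?c\<bar> \<le> s\<^sup>2 * (6 * L\<^sup>2 * e')"
        by (simp add: abs_mult power_mult_distrib mult_ac)
      then have "\<bar>?c\<bar> \<le> 6 * L\<^sup>2 * e'" using s by simp
      also have "\<dots> \<le> (6 * L\<^sup>2 + 1) * e'" using e' by (simp add: distrib_right)
      also have "\<dots> = e"
        using add_nonneg_pos[of "6 * L\<^sup>2" 1] by (simp add: e'_def)
      finally show ?thesis by simp
    qed
    then have "\<bar>?c\<bar> \<le> 0" by (rule field_le_epsilon)
    then show ?thesis by simp
  qed
  then show ?thesis by (intro symmetric_matrixI) simp
qed

text \<open>Division by zero gives the quotient the value 0 at the origin, so continuity there
  expresses the \<open>o(|y|^2)\<close> estimate and can be composed with curves that may pass
  through the origin.\<close>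

lemma taylor_remainder_little_o:
  fixes f :: "real^'n \<Rightarrow> real"
  assumes "open S" "x \<in> S" "C2_on S f"
  shows "isCont (\<lambda>y. taylor_remainder f x (gradient f x) (hessian f x) y / (norm y)\<^sup>2) 0"
    (is "isCont ?Q 0")
  unfolding continuous_at_eps_delta
proof (intro allI impI)
  fix e :: real assume "e > 0"
  then obtain d where d: "0 < d" 
    "\<And>y. norm y < d \<Longrightarrow>
      \<bar>taylor_remainder f x (gradient f x) (hessian f x) y\<bar> \<le> e / 2 * (norm y)\<^sup>2"
    using taylor_remainder_bound[OF assms, of "e / 2"] by (metis half_gt_zero)
  have "\<bar>?Q y\<bar> < e" if "norm y < d" for y
  proof -
    have "\<bar>?Q y\<bar> \<le> e / 2"
      using d(2)[OF that] \<open>e > 0\<close>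
      by (cases "y = 0") (auto simp: abs_divide pos_divide_le_eq)
    then show ?thesis using \<open>e > 0\<close> by linarith
  qed
  then show "\<exists>d>0. \<forall>y. dist y 0 < d \<longrightarrow> dist (?Q y) (?Q 0) < e"
    using d(1) by (auto simp: dist_norm)
qed

text \<open>Along a curve with velocity \<open>w\<close> whose second-order coefficient tends to
  \<open>B\<close>, the expansion of \<open>f\<close> is \<open>t\<close> times the first-order term
  plus \<open>t^2\<close> times a convergent term. Both signs of \<open>t\<close> force the former
  to vanish; then the sign of the latter remains. A mere limit of \<open>\<beta>\<close> suffices,
  so that curves in the graph of a \<open>C2_on\<close> function are covered.\<close>

lemma second_order_along_curve:
  fixes f :: "real^'n \<Rightarrow> real" and \<beta> :: "real \<Rightarrow> real^'n"
  assumes S: "open S" "x \<in> S" "C2_on S f"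
    and \<beta>: "(\<beta> \<longlongrightarrow> B) (at 0)"
    and le: "\<forall>\<^sub>F t in at 0. f (x + t *\<^sub>R w + t\<^sup>2 *\<^sub>R \<beta> t) \<le> f x"
  shows "gradient f x \<bullet> w = 0"
    and "w \<bullet> (hessian f x *v w) + 2 * (gradient f x \<bullet> B) \<le> 0"
proof -
  let ?g = "gradient f x" and ?G = "hessian f x"
  define Q where "Q y = taylor_remainder f x ?g ?G y / (norm y)\<^sup>2" for y
  define \<delta> where "\<delta> t = w + t *\<^sub>R \<beta> t" for t
  \<comment> \<open>\<open>E t\<close> collects everything of second order, divided by
    \<open>t^2\<close>.\<close>
  define E where "E t = ?g \<bullet> \<beta> t + (\<delta> t \<bullet> (?G *v \<delta> t)) / 2 + Q (t *\<^sub>R \<delta> t) * (norm (\<delta> t))\<^sup>2" for t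
  have R: "taylor_remainder f x ?g ?G y = Q y * (norm y)\<^sup>2" for y
    by (cases "y = 0") (auto simp: Q_def taylor_remainder_def)
  have expand: "f (x + t *\<^sub>R w + t\<^sup>2 *\<^sub>R \<beta> t) - f x = t * (?g \<bullet> w + t * E t)" for t
  proof -
    have "t *\<^sub>R w + t\<^sup>2 *\<^sub>R \<beta> t = t *\<^sub>R \<delta> t"
      by (simp add: \<delta>_def scaleR_add_right power2_eq_square)
    then have "f (x + t *\<^sub>R w + t\<^sup>2 *\<^sub>R \<beta> t) - f x
        = ?g \<bullet> (t *\<^sub>R \<delta> t) + ((t *\<^sub>R \<delta> t) \<bullet> (?G *v (t *\<^sub>R \<delta> t))) / 2
          + Q (t *\<^sub>R \<delta> t) * (norm (t *\<^sub>R \<delta> t))\<^sup>2"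
      using R[of "t *\<^sub>R \<delta> t"] by (simp add: taylor_remainder_def add.assoc)
    also have "?g \<bullet> (t *\<^sub>R \<delta> t) = t * (?g \<bullet> w) + t\<^sup>2 * (?g \<bullet> \<beta> t)"
      by (simp add: \<delta>_def inner_add_right distrib_left power2_eq_square)
    finally show ?thesis
      by (simp add: E_def matrix_vector_mult_scaleR power_mult_distrib power2_eq_square algebra_simps)
  qed
  have \<delta>: "(\<delta> \<longlongrightarrow> w) (at 0)"
    unfolding \<delta>_def by (rule tendsto_eq_intros \<beta> refl)+ simp
  have G\<delta>: "((\<lambda>t. ?G *v \<delta> t) \<longlongrightarrow> ?G *v w) (at 0)"
    by (rule bounded_linear.tendsto[OF matrix_vector_mul_bounded_linear \<delta>])
  have "((\<lambda>t. t *\<^sub>R \<delta> t) \<longlongrightarrow> 0) (at 0)"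
    by (rule tendsto_eq_intros \<delta> refl)+ simp
  then have "((\<lambda>t. Q (t *\<^sub>R \<delta> t)) \<longlongrightarrow> Q 0) (at 0)"
    using taylor_remainder_little_o[OF S] unfolding Q_def[symmetric] by (rule isCont_tendsto_compose[rotated])
  then have "(E \<longlongrightarrow> ?g \<bullet> B + (w \<bullet> (?G *v w)) / 2 + 0 * (norm w)\<^sup>2) (at 0)"
    unfolding E_def by (intro tendsto_intros \<beta> \<delta> G\<delta>) (simp_all add: Q_def)
  then have E: "(E \<longlongrightarrow> ?g \<bullet> B + (w \<bullet> (?G *v w)) / 2) (at 0)" by simp
  have lim: "((\<lambda>t. ?g \<bullet> w + t * E t) \<longlongrightarrow> ?g \<bullet> w) (at 0)"
    by (rule tendsto_eq_intros E refl)+ simp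
  \<comment> \<open>Dividing by \<open>t\<close> from the right and from the left yields the two
    inequalities for the first-order term.\<close>
  have le': "\<forall>\<^sub>F t in at 0. t * (?g \<bullet> w + t * E t) \<le> 0"
    using le by eventually_elim (use expand in \<open>metis diff_le_0_iff_le\<close>)
  have "?g \<bullet> w \<le> 0"
  proof (rule tendsto_upperbound)
    show "((\<lambda>t. ?g \<bullet> w + t * E t) \<longlongrightarrow> ?g \<bullet> w) (at_right 0)"
      using lim by (simp add: filterlim_at_split)
    have "\<forall>\<^sub>F t in at_right 0. t * (?g \<bullet> w + t * E t) \<le> 0"
      using le' by (simp add: eventually_at_split)
    moreover have "\<forall>\<^sub>F t in at_right (0::real). t > 0" by (rule eventually_at_right_less)
    ultimately show "\<forall>\<^sub>F t in at_right 0. ?g \<bullet> w + t * E t \<le> 0"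
      by eventually_elim (simp add: mult_le_0_iff)
  qed simp
  moreover have "?g \<bullet> w \<ge> 0"
  proof (rule tendsto_lowerbound)
    show "((\<lambda>t. ?g \<bullet> w + t * E t) \<longlongrightarrow> ?g \<bullet> w) (at_left 0)"
      using lim by (simp add: filterlim_at_split)
    have "\<forall>\<^sub>F t in at_left 0. t * (?g \<bullet> w + t * E t) \<le> 0"
      using le' by (simp add: eventually_at_split)
    moreover have "\<forall>\<^sub>F t in at_left (0::real). t < 0"
      by (simp add: eventually_at_filter)
    ultimately show "\<forall>\<^sub>F t in at_left 0. ?g \<bullet> w + t * E t \<ge> 0"
      by eventually_elim (simp add: mult_le_0_iff)
  qed simp
  ultimately show w: "?g \<bullet> w = 0" by simp
  have "?g \<bullet> B + (w \<bullet> (?G *v w)) / 2 \<le> 0"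
  proof (rule tendsto_upperbound[OF E])
    have "\<forall>\<^sub>F t in at (0::real). t \<noteq> 0" by (simp add: eventually_at_filter)
    with le' show "\<forall>\<^sub>F t in at 0. E t \<le> 0"
      by eventually_elim (auto simp: w mult_le_0_iff zero_le_mult_iff)
  qed simp
  then show "w \<bullet> (?G *v w) + 2 * (?g \<bullet> B) \<le> 0" by simp
qed

text \<open>The quartic term does not affect the Hessian at \<open>p\<close>, so \<open>C\<close> is
  free to control the function far from \<open>p\<close>.\<close>

lemma quadratic_minus_quartic:
  fixes A :: "real^'n^'n" and a p :: "real^'n" and C :: real
  assumes A: "transpose A = A"
  defines "\<phi> \<equiv> \<lambda>x. a \<bullet> (x - p) + ((x - p) \<bullet> (A *v (x - p))) / 2 - C * ((x - p) \<bullet> (x - p))\<^sup>2"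
  shows "C2_on S \<phi>" and "hessian \<phi> p = A"
proof -
  \<comment> \<open>\<open>g\<close> and \<open>h x\<close> are the candidates for the gradient and
    for its derivative at \<open>x\<close>.\<close>
  define g where "g x = a + A *v (x - p) - (4 * C * ((x - p) \<bullet> (x - p))) *\<^sub>R (x - p)" for x
  define h where "h x v = A *v v - (4 * C * ((x - p) \<bullet> (x - p))) *\<^sub>R v
    - (8 * C * ((x - p) \<bullet> v)) *\<^sub>R (x - p)" for x v
  have A_der: "((\<lambda>x. A *v (x - p)) has_derivative (\<lambda>v. A *v v)) (at x)" for x
    by (intro bounded_linear.has_derivative[OF matrix_vector_mul_bounded_linear])
      (auto intro!: derivative_eq_intros)
  have id_der: "((\<lambda>x. x - p) has_derivative (\<lambda>v. v)) (at x)" for x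
    by (auto intro!: derivative_eq_intros)
  have N_der: "((\<lambda>x. (x - p) \<bullet> (x - p)) has_derivative (\<lambda>v. 2 * ((x - p) \<bullet> v))) (at x)" for x
    using has_derivative_inner[OF id_der id_der] by (simp add: inner_commute)
  have Q_der: "((\<lambda>x. (x - p) \<bullet> (A *v (x - p))) has_derivative (\<lambda>v. 2 * ((A *v (x - p)) \<bullet> v))) (at x)" for x
    using has_derivative_inner[OF id_der A_der] by (simp add: symmetric_matrix_inner[OF A] inner_commute)
  have L_der: "((\<lambda>x. a \<bullet> (x - p)) has_derivative (\<lambda>v. a \<bullet> v)) (at x)" for x
    using has_derivative_inner_right[OF id_der] .
  have "(\<phi> has_derivative (\<lambda>v. a \<bullet> v + (2 * ((A *v (x - p)) \<bullet> v)) * (1/2)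
      - C * (((x - p) \<bullet> (x - p)) * (2 * ((x - p) \<bullet> v)) + (2 * ((x - p) \<bullet> v)) * ((x - p) \<bullet> (x - p))))) (at x)"
    for x
    using has_derivative_diff[OF has_derivative_add[OF L_der has_derivative_mult_left[OF Q_der, of "1/2"]]
        has_derivative_mult_right[OF has_derivative_mult[OF N_der N_der], of C]]
    by (simp add: \<phi>_def power2_eq_square)
  then have \<phi>_der: "(\<phi> has_derivative (\<lambda>v. g x \<bullet> v)) (at x)" for x
    by (rule has_derivative_eq_rhs) (simp add: fun_eq_iff g_def inner_diff_left inner_add_left)
  have grad: "gradient \<phi> = g"
    using gradient_eqI[OF \<phi>_der] by blast
  have g_der: "(g has_derivative h x) (at x)" for x
    unfolding g_def
    by (rule A_der N_der derivative_eq_intros refl)+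
      (auto simp: fun_eq_iff h_def algebra_simps)
  have lin: "linear (h x)" for x using g_der by (rule has_derivative_linear)
  have hess: "hessian \<phi> x = matrix (h x)" for x
    by (rule hessian_eqI) (use g_der[of x] lin[of x] in \<open>simp add: grad matrix_works\<close>)
  have "continuous_on S (\<lambda>x. matrix (h x))"
    unfolding matrix_def h_def
    by (intro continuous_intros)
  then show "C2_on S \<phi>"
    using \<phi>_der g_der by (auto simp: C2_on_def grad hess[abs_def] differentiable_def)
  have "h p = (\<lambda>v. A *v v)" by (simp add: h_def fun_eq_iff)
  then show "hessian \<phi> p = A" by (simp add: hess)
qed

section \<open>Rigid transformations and local graph coordinates\<close>

text \<open>An isometry fixing the origin preserves norms and differences of norms, hence inner
  products by polarisation; linearity follows by comparing inner products. \<open>M\<close> is the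
  inverse of the linear part \<open>L\<close>.\<close>

lemma surj_isometry_imp_linear:
  fixes \<rho> :: "'a::real_inner \<Rightarrow> 'b::real_inner"
  assumes surj: "surj \<rho>" and dist: "\<And>x y. dist (\<rho> x) (\<rho> y) = dist x y" and p: "\<rho> p = 0"
  obtains L M where "linear L" "linear M" "\<forall>y. \<rho> (p + y) = L y"
    "\<forall>y. M (L y) = y" "\<forall>z. L (M z) = z"
    "\<forall>x y. L x \<bullet> L y = x \<bullet> y" "\<forall>x y. M x \<bullet> M y = x \<bullet> y"
proof -
  define L where "L y = \<rho> (p + y)" for y
  have diff: "norm (L x - L y) = norm (x - y)" for x y
    using dist[of "p + x" "p + y"] by (simp add: L_def dist_norm)
  have L0: "L 0 = 0" using p by (simp add: L_def)
  have nrm: "norm (L x) = norm x" for x using diff[of x 0] L0 by simp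
  have inner: "L x \<bullet> L y = x \<bullet> y" for x y
    unfolding dot_norm_neg by (simp add: diff nrm)
  have lin: "linear L"
    by (rule linearI; subst vector_eq)
      (simp_all add: inner inner_add_left inner_add_right inner_commute)
  have bij: "bij L"
  proof (rule bijI)
    show "inj L"
    proof (rule injI)
      fix x y assume "L x = L y"
      then show "x = y" using diff[of x y] by simp
    qed
    show "surj L"
      unfolding surj_def
    proof
      fix z obtain x where "z = \<rho> x" using surj by (meson surjD)
      then have "z = L (x - p)" by (simp add: L_def)
      then show "\<exists>x. z = L x" by blast
    qed
  qed
  have left_inv: "inv L (L y) = y" for y using bij by (simp add: bij_is_inj)
  have right_inv: "L (inv L z) = z" for z using bij by (simp add: bij_is_surj surj_f_inv_f)
  have "linear (inv L)"
  proof (rule linearI)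
    fix x y :: 'b and c :: real
    have "inv L (x + y) = inv L (L (inv L x + inv L y))"
      using lin by (simp add: linear_add right_inv)
    then show "inv L (x + y) = inv L x + inv L y" by (simp only: left_inv)
    have "inv L (c *\<^sub>R x) = inv L (L (c *\<^sub>R inv L x))"
      using lin by (simp add: linear_cmul right_inv)
    then show "inv L (c *\<^sub>R x) = c *\<^sub>R inv L x" by (simp only: left_inv)
  qed
  moreover have "inv L x \<bullet> inv L y = x \<bullet> y" for x y
    using inner[of "inv L x" "inv L y"] by (simp add: right_inv)
  ultimately show ?thesis
    using that[of L "inv L"] lin left_inv right_inv inner by (simp add: L_def)
qed

lemma local_graphD:
  assumes "local_graph \<Omega> U p \<rho> r f"
  shows "surj \<rho>" "dist (\<rho> x) (\<rho> y) = dist x y" "\<rho> p = 0" "r > 0" "ball 0 r \<subseteq> \<rho> ` \<Omega>"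
    "C2_on (ball 0 r) f" "f 0 = 0" "gradient f 0 = 0"
    "\<rho> ` U \<inter> ball 0 r = {(x', xN). (x', xN) \<in> ball 0 r \<and> xN > f x'}"
  using assms unfolding local_graph_def by blast+

text \<open>Translates membership in \<open>\<Omega>\<close> and \<open>U\<close> into graph
  coordinates; injectivity of \<open>\<rho>\<close> makes passing through images harmless.\<close>

lemma local_graph_mem:
  assumes G: "local_graph \<Omega> U p \<rho> r f"
    and L: "\<And>y. \<rho> (p + y) = L y" "\<And>y. M (L y) = y" "\<And>z. L (M z) = z"
    and z: "z \<in> ball 0 r"
  shows "p + M z \<in> \<Omega>" and "p + M z \<in> U \<longleftrightarrow> snd z > f (fst z)"
proof -
  have \<rho>: "\<rho> (p + M z) = z" by (simp add: L)
  have inj: "x = p + M z" if "\<rho> x = z" for x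
    using L(1,2)[of "x - p"] that by simp
  have "z \<in> \<rho> ` \<Omega>" using local_graphD(5)[OF G] z by blast
  then obtain x where "x \<in> \<Omega>" "\<rho> x = z" by blast
  then show "p + M z \<in> \<Omega>" using inj[of x] by simp
  have "p + M z \<in> U \<longleftrightarrow> z \<in> \<rho> ` U \<inter> ball 0 r" using inj \<rho> z by (metis IntD1 IntI imageE imageI)
  also have "\<dots> \<longleftrightarrow> snd z > f (fst z)"
    unfolding local_graphD(9)[OF G] using z by (cases z) simp
  finally show "p + M z \<in> U \<longleftrightarrow> snd z > f (fst z)" .
qed

text \<open>Since \<open>f\<close> and its gradient vanish at 0, the Hessian term leads the Taylor
  expansion along \<open>t *\<^sub>R w\<close>.\<close>

lemma local_graph_second_order:
  fixes f :: "real^'m \<Rightarrow> real" and w :: "real^'m"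
  assumes G: "local_graph \<Omega> U p \<rho> r f"
  shows "((\<lambda>t. f (t *\<^sub>R w) / t\<^sup>2) \<longlongrightarrow> (w \<bullet> (hessian f 0 *v w)) / 2) (at 0)"
proof -
  note f = local_graphD(6-8,4)[OF G]
  define Q where "Q y = taylor_remainder f 0 (gradient f 0) (hessian f 0) y / (norm y)\<^sup>2" for y
  have "((\<lambda>t. t *\<^sub>R w) \<longlongrightarrow> 0) (at 0)"
    by (rule tendsto_eq_intros refl)+ simp
  then have "((\<lambda>t. Q (t *\<^sub>R w)) \<longlongrightarrow> Q 0) (at 0)"
    using taylor_remainder_little_o[OF open_ball _ f(1), of 0] f(4)
    unfolding Q_def[symmetric] by (intro isCont_tendsto_compose[of 0 Q]) auto
  then have lim: "((\<lambda>t. Q (t *\<^sub>R w) * (norm w)\<^sup>2 + (w \<bullet> (hessian f 0 *v w)) / 2)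
      \<longlongrightarrow> 0 * (norm w)\<^sup>2 + (w \<bullet> (hessian f 0 *v w)) / 2) (at 0)"
    by (intro tendsto_intros) (simp add: Q_def)
  have "f (t *\<^sub>R w) / t\<^sup>2 = Q (t *\<^sub>R w) * (norm w)\<^sup>2 + (w \<bullet> (hessian f 0 *v w)) / 2"
    if "t \<noteq> 0" for t
  proof (cases "w = 0")
    case False
    then show ?thesis
      using that f by (simp add: Q_def taylor_remainder_def matrix_vector_mult_scaleR
          power_mult_distrib power2_eq_square field_simps)
  qed (use f in simp)
  then have "\<forall>\<^sub>F t in at 0. Q (t *\<^sub>R w) * (norm w)\<^sup>2 + (w \<bullet> (hessian f 0 *v w)) / 2
      = f (t *\<^sub>R w) / t\<^sup>2"
    by (simp add: eventually_at_filter)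
  from Lim_transform_eventually[OF lim this] show ?thesis by simp
qed

section \<open>From the curvature inequality to condition G\<close>

lemma P_minus_hessian_le_0_interior:
  fixes \<phi> :: "real^'n \<Rightarrow> real"
  assumes C2: "open S" "C2_on S \<phi>" and p: "p \<in> S" and max: "\<And>x. x \<in> S \<Longrightarrow> \<phi> x \<le> \<phi> p"
    and k: "k \<le> CARD('n)"
  shows "P_minus k (hessian \<phi> p) \<le> 0"
proof -
  let ?G = "hessian \<phi> p"
  obtain v where v: "P_minus k ?G = (\<Sum>i=1..k. v i \<bullet> (?G *v v i))"
    using P_minus_eq_trace[OF hessian_symmetric[OF C2(1) p C2(2)] k] by blast
  have "w \<bullet> (?G *v w) \<le> 0" for w
  proof -
    have "((\<lambda>t. p + t *\<^sub>R w) \<longlongrightarrow> p) (at 0)"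
      by (rule tendsto_eq_intros refl)+ simp
    then have "\<forall>\<^sub>F t in at 0. p + t *\<^sub>R w \<in> S"
      using C2(1) p by (rule topological_tendstoD)
    then have "\<forall>\<^sub>F t in at 0. \<phi> (p + t *\<^sub>R w + t\<^sup>2 *\<^sub>R 0) \<le> \<phi> p"
      by eventually_elim (simp add: max)
    then show ?thesis
      using second_order_along_curve(2)[OF C2(1) p C2(2), of "\<lambda>_. 0" 0 w] by simp
  qed
  then show ?thesis unfolding v by (simp add: sum_nonpos)
qed

text \<open>Admissible curves give a nonnegative multiplier \<open>?g \<bullet> N\<close> and bound
  the tangential Hessian of \<open>\<phi>\<close> by minus that multiplier times the Hessian of
  \<open>f\<close>. Tracing over the directions of the \<open>k\<close> largest curvatures
  concludes.\<close>

lemma P_minus_hessian_le_0_boundary: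
  fixes \<phi> :: "real^'n \<Rightarrow> real" and f :: "real^'m \<Rightarrow> real"
  assumes C2: "open \<Omega>" "C2_on \<Omega> \<phi>" and p: "p \<in> \<Omega>"
    and max: "\<And>x. x \<in> \<Omega> - U \<Longrightarrow> \<phi> x \<le> \<phi> p"
    and G: "local_graph \<Omega> U p \<rho> r f"
    and k: "1 \<le> k" "k \<le> CARD('m)" "k \<le> CARD('n)"
    and curv: "(\<Sum>i=1..k. eigenvalue (hessian f 0) (CARD('m) + 1 - i)) \<ge> 0"
  shows "P_minus k (hessian \<phi> p) \<le> 0"
proof -
  let ?G = "hessian \<phi> p" and ?H = "hessian f 0" and ?g = "gradient \<phi> p"
  note f = local_graphD(6,7,4)[OF G] and \<rho> = local_graphD(1-3)[OF G]
  obtain L M where lin: "linear L" "linear M" and LM': "\<forall>y. \<rho> (p + y) = L y"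
    "\<forall>y. M (L y) = y" "\<forall>z. L (M z) = z"
    and iso': "\<forall>x y. L x \<bullet> L y = x \<bullet> y" "\<forall>x y. M x \<bullet> M y = x \<bullet> y"
    by (rule surj_isometry_imp_linear[OF \<rho>])
  note LM = LM'[rule_format] and iso = iso'[rule_format]
  have below: "\<phi> (p + M z) \<le> \<phi> p" if "z \<in> ball 0 r" "snd z \<le> f (fst z)" for z
    using local_graph_mem[OF G LM that(1)] that(2) by (intro max) auto
  \<comment> \<open>The unit normal pointing into \<open>U\<close>, which lies above the
    graph.\<close>
  define N where "N = M (0, 1)"
  have M_split: "M (w, s) = M (w, 0) + s *\<^sub>R N" for w s
  proof -
    have "M (w, s) = M ((w, 0) + s *\<^sub>R (0, 1))" by simp
    then show ?thesis using lin(2) by (simp only: N_def linear_add linear_cmul)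
  qed
  have M_scale: "M (t *\<^sub>R w, 0) = t *\<^sub>R M (w, 0)" for t w
    using linear_cmul[OF lin(2), of t "(w, 0)"] by simp
  have in_ball: "\<forall>\<^sub>F t in at 0. h t \<in> ball 0 r" if "(h \<longlongrightarrow> 0) (at 0)"
    for h :: "real \<Rightarrow> (real^'m) \<times> real"
    using topological_tendstoD[OF that open_ball, of 0 r] f(3) by simp
  have \<mu>: "?g \<bullet> N \<ge> 0"
  proof -
    \<comment> \<open>The curve \<open>p - t^2 N\<close> has zero velocity and stays below the
      graph; its second-order coefficient \<open>- N\<close> yields the sign of the
      multiplier.\<close>
    have "((\<lambda>t::real. (0 :: real^'m, - t\<^sup>2)) \<longlongrightarrow> (0, - 0\<^sup>2)) (at 0)"
      by (intro tendsto_intros)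
    then have "\<forall>\<^sub>F t in at 0. (0, - t\<^sup>2) \<in> ball (0 :: (real^'m) \<times> real) r"
      by (intro in_ball) (simp add: zero_prod_def)
    then have "\<forall>\<^sub>F t in at 0. \<phi> (p + t *\<^sub>R 0 + t\<^sup>2 *\<^sub>R (- N)) \<le> \<phi> p"
    proof eventually_elim
      case (elim t)
      then show ?case
        using below[OF elim] f(2) M_split[of 0 "- t\<^sup>2"] linear_0[OF lin(2)]
        by (simp add: zero_prod_def)
    qed
    from second_order_along_curve(2)[OF C2(1) p C2(2) tendsto_const this] show ?thesis by simp
  qed
  have second: "M (w, 0) \<bullet> (?G *v M (w, 0)) \<le> - (?g \<bullet> N) * (w \<bullet> (?H *v w))" for w
  proof -
    \<comment> \<open>This correction lifts the tangent line onto the graph itself, whose points are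
      outside \<open>U\<close> because \<open>U\<close> is strictly above it.\<close>
    let ?\<beta> = "\<lambda>t. (f (t *\<^sub>R w) / t\<^sup>2) *\<^sub>R N"
    have \<beta>: "(?\<beta> \<longlongrightarrow> ((w \<bullet> (?H *v w)) / 2) *\<^sub>R N) (at 0)"
      by (intro tendsto_intros local_graph_second_order[OF G])
    have w: "((\<lambda>t. t *\<^sub>R w) \<longlongrightarrow> 0) (at 0)"
      by (rule tendsto_eq_intros refl)+ simp
    have "isCont f 0"
      using C2_onD(1)[OF f(1), of 0] f(3) has_derivative_continuous by auto
    then have "((\<lambda>t. (t *\<^sub>R w, f (t *\<^sub>R w))) \<longlongrightarrow> (0, f 0)) (at 0)"
      by (intro tendsto_Pair w isCont_tendsto_compose[of 0 f])
    then have "\<forall>\<^sub>F t in at 0. (t *\<^sub>R w, f (t *\<^sub>R w)) \<in> ball 0 r"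
      by (intro in_ball) (simp add: zero_prod_def f(2))
    moreover have "\<forall>\<^sub>F t in at (0::real). t \<noteq> 0" by (simp add: eventually_at_filter)
    ultimately have "\<forall>\<^sub>F t in at 0. \<phi> (p + t *\<^sub>R M (w, 0) + t\<^sup>2 *\<^sub>R ?\<beta> t) \<le> \<phi> p"
    proof eventually_elim
      case (elim t)
      then show ?case
        using below[OF elim(1)] by (simp add: M_split[of "t *\<^sub>R w" "f (t *\<^sub>R w)"] M_scale add.assoc)
    qed
    from second_order_along_curve(2)[OF C2(1) p C2(2) \<beta> this] show ?thesis by (simp add: mult.commute)
  qed
  have "transpose ?H = ?H" using hessian_symmetric[OF open_ball _ f(1), of 0] f(3) by simp
  then obtain e where e: "orthonormal_on {1..CARD('m)} e"
    "\<forall>i\<in>{1..CARD('m)}. ?H *v e i = eigenvalue ?H i *\<^sub>R e i"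
    "mono_on {1..CARD('m)} (eigenvalue ?H)"
    by (rule symmetric_matrix_spectral)
  \<comment> \<open>Reversing the numbering selects eigenvectors of the \<open>k\<close> largest
    curvatures.\<close>
  define v where "v i = M (e (CARD('m) + 1 - i), 0)" for i
  have idx: "CARD('m) + 1 - i \<in> {1..CARD('m)}" if "i \<in> {1..k}" for i
    using that k by auto
  have v: "orthonormal_on {1..k} v"
    unfolding orthonormal_on_def
  proof (intro ballI)
    fix i j assume ij: "i \<in> {1..k}" "j \<in> {1..k}"
    then have "CARD('m) + 1 - i = CARD('m) + 1 - j \<longleftrightarrow> i = j" using k by auto
    then show "v i \<bullet> v j = (if i = j then 1 else 0)"
      using orthonormal_onD[OF e(1) idx[OF ij(1)] idx[OF ij(2)]] by (simp add: v_def iso inner_Pair)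
  qed
  have "P_minus k ?G \<le> (\<Sum>i=1..k. v i \<bullet> (?G *v v i))"
    by (rule P_minus_le_trace) (use hessian_symmetric[OF C2(1) p C2(2)] k v in auto)
  also have "\<dots> \<le> (\<Sum>i=1..k. - (?g \<bullet> N) * eigenvalue ?H (CARD('m) + 1 - i))"
  proof (rule sum_mono)
    fix i assume "i \<in> {1..k}"
    note i = idx[OF this]
    have "e (CARD('m) + 1 - i) \<bullet> (?H *v e (CARD('m) + 1 - i)) = eigenvalue ?H (CARD('m) + 1 - i)"
      using e(2) i orthonormal_onD[OF e(1) i i] by simp
    then show "v i \<bullet> (?G *v v i) \<le> - (?g \<bullet> N) * eigenvalue ?H (CARD('m) + 1 - i)"
      using second[of "e (CARD('m) + 1 - i)"] by (simp add: v_def)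
  qed
  also have "\<dots> = - (?g \<bullet> N) * (\<Sum>i=1..k. eigenvalue ?H (CARD('m) + 1 - i))"
    by (simp add: sum_distrib_left)
  also have "\<dots> \<le> 0" using \<mu> curv by (simp add: mult_nonneg_nonneg)
  finally show ?thesis .
qed

section \<open>From condition G to the curvature inequality: the test function\<close>

text \<open>
  On \<open>t \<le> f w\<close> the increasing function \<open>t + c t\<^sup>2\<close> is at most \<open>f w + c (f w)\<^sup>2\<close>,
  whose second summand is of fourth order.
\<close>

lemma below_graph_quadratic_bound:
  fixes f :: "real^'m \<Rightarrow> real"
  assumes f: "C2_on (ball 0 r) f" "f 0 = 0" "gradient f 0 = 0" "r > 0"
    and c: "c > 0" and e: "\<epsilon> > 0"
  obtains \<delta> where "0 < \<delta>" "\<delta> \<le> r"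
    "\<And>w t. norm (w, t) < \<delta> \<Longrightarrow> t \<le> f w \<Longrightarrow>
      t + c * t\<^sup>2 \<le> (w \<bullet> (hessian f 0 *v w)) / 2 + \<epsilon> / 2 * (w \<bullet> w)"
proof -
  let ?H = "hessian f 0"
  have e4: "\<epsilon> / 4 > 0" using e by simp
  have 0: "0 \<in> ball (0::real^'m) r" using f by simp
  obtain d where d: "0 < d" "\<And>w. norm w < d \<Longrightarrow>
      \<bar>taylor_remainder f 0 (gradient f 0) ?H w\<bar> \<le> \<epsilon> / 4 * (norm w)\<^sup>2"
    using taylor_remainder_bound[OF open_ball 0 f(1) e4] by metis
  obtain B where B: "B > 0" "\<And>w. norm (?H *v w) \<le> norm w * B"
    using bounded_linear.pos_bounded[OF matrix_vector_mul_bounded_linear[of ?H]] by blast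
  \<comment> \<open>Chosen so that \<open>|f w| \<le> D |w|^2\<close> near 0.\<close>
  define D where "D = B / 2 + \<epsilon> / 4"
  have D: "D > 0" using B e by (simp add: D_def)
  \<comment> \<open>\<open>r\<close> and \<open>d\<close> keep the Taylor bound valid, 1 gives
    \<open>n^2 \<le> \<delta>\<close>, the next two entries bound \<open>|t|\<close> and
    \<open>|f w|\<close> by \<open>1 / (2 c)\<close>, and the last makes \<open>c (f w)^2\<close> at
    most \<open>\<epsilon> / 4 * n^2\<close>.\<close>
  define \<delta> where "\<delta> = Min {r, d, 1, 1 / (2 * c), 1 / (2 * c * D), \<epsilon> / (4 * c * D\<^sup>2)}"
  have \<delta>: "\<delta> \<le> r" "\<delta> \<le> d" "\<delta> \<le> 1" "\<delta> \<le> 1 / (2 * c)" "\<delta> \<le> 1 / (2 * c * D)" "\<delta> \<le> \<epsilon> / (4 * c * D\<^sup>2)"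
    unfolding \<delta>_def by (rule Min_le; simp)+
  have "0 < \<delta>" using f d c D e by (simp add: \<delta>_def)
  moreover have "t + c * t\<^sup>2 \<le> (w \<bullet> (?H *v w)) / 2 + \<epsilon> / 2 * (w \<bullet> w)"
    if wt: "norm (w, t) < \<delta>" and le: "t \<le> f w" for w t
  proof -
    define n where "n = norm w"
    have n: "0 \<le> n" "n < \<delta>" "\<bar>t\<bar> < \<delta>"
      using wt norm_fst_le[of w t] norm_snd_le[of t w] by (auto simp: n_def)
    have T: "\<bar>f w - (w \<bullet> (?H *v w)) / 2\<bar> \<le> \<epsilon> / 4 * n\<^sup>2"
      using d(2)[of w] n \<delta> f by (simp add: taylor_remainder_def n_def)
    have "\<bar>w \<bullet> (?H *v w)\<bar> \<le> norm w * (norm w * B)"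
      by (rule order_trans[OF Cauchy_Schwarz_ineq2]) (intro mult_left_mono B norm_ge_zero)
    then have "\<bar>w \<bullet> (?H *v w)\<bar> \<le> B * n\<^sup>2"
      by (simp add: n_def power2_eq_square mult_ac)
    moreover have "D * n\<^sup>2 = B * n\<^sup>2 / 2 + \<epsilon> / 4 * n\<^sup>2"
      by (simp add: D_def distrib_right)
    ultimately have fD: "\<bar>f w\<bar> \<le> D * n\<^sup>2"
      using T by linarith
    have n2: "n\<^sup>2 \<le> \<delta>" 
    proof -
      have "n\<^sup>2 \<le> \<delta> * 1"
        unfolding power2_eq_square using n \<delta> by (intro mult_mono) auto
      then show ?thesis by simp
    qed
    have "D * n\<^sup>2 \<le> D * \<delta>" using n2 D by simp
    also have "\<dots> \<le> D * (1 / (2 * c * D))" using \<delta>(5) D by (intro mult_left_mono) auto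
    also have "\<dots> = 1 / (2 * c)" using D by simp
    finally have f_small: "\<bar>f w\<bar> \<le> 1 / (2 * c)" using fD by linarith
    have "c * (f w)\<^sup>2 \<le> c * (D * n\<^sup>2)\<^sup>2"
      using fD c by (intro mult_left_mono) (auto simp: abs_le_square_iff[symmetric])
    also have "\<dots> = (c * D\<^sup>2 * n\<^sup>2) * n\<^sup>2" by (simp add: power2_eq_square)
    also have "\<dots> \<le> (c * D\<^sup>2 * (\<epsilon> / (4 * c * D\<^sup>2))) * n\<^sup>2"
      using n2 \<delta>(6) c D by (intro mult_right_mono mult_left_mono) auto
    also have "\<dots> = \<epsilon> / 4 * n\<^sup>2" using c D by simp
    finally have f2: "c * (f w)\<^sup>2 \<le> \<epsilon> / 4 * n\<^sup>2" .
    have "- (1 / c) \<le> f w + t"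
      using f_small n(3) \<delta>(4) by (simp add: abs_le_iff) linarith
    then have "0 \<le> 1 + c * (f w + t)"
      using c by (simp add: field_simps)
    \<comment> \<open>The product is the increment of \<open>t + c t^2\<close> from \<open>t\<close>
      to \<open>f w\<close>.\<close>
    then have "0 \<le> (f w - t) * (1 + c * (f w + t))"
      using le by (intro mult_nonneg_nonneg) auto
    then have "t + c * t\<^sup>2 \<le> f w + c * (f w)\<^sup>2"
      by (simp add: power2_eq_square algebra_simps)
    also have "\<dots> \<le> (w \<bullet> (?H *v w)) / 2 + \<epsilon> / 4 * n\<^sup>2 + \<epsilon> / 4 * n\<^sup>2"
      using T f2 by linarith
    finally show ?thesis by (simp add: n_def power2_norm_eq_inner)
  qed
  ultimately show ?thesis using that \<delta>(1) by blast
qed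

text \<open>For \<open>|y| \<ge> \<delta>\<close> the powers \<open>|y|\<close> and
  \<open>|y|^2\<close> are at most \<open>|y|^4 / \<delta>^3\<close> and
  \<open>|y|^4 / \<delta>^2\<close>.\<close>

lemma far_quartic_bound:
  fixes A :: "real^'n^'n" and a :: "real^'n"
  assumes "\<delta> > 0"
  obtains C where "C \<ge> 0" "\<And>y. norm y \<ge> \<delta> \<Longrightarrow> a \<bullet> y + (y \<bullet> (A *v y)) / 2 \<le> C * (y \<bullet> y)\<^sup>2"
proof -
  obtain B where B: "B > 0" "\<And>w. norm (A *v w) \<le> norm w * B"
    using bounded_linear.pos_bounded[OF matrix_vector_mul_bounded_linear[of A]] by blast
  define C where "C = norm a / \<delta> ^ 3 + B / (2 * \<delta>\<^sup>2)"
  have "a \<bullet> y + (y \<bullet> (A *v y)) / 2 \<le> C * (y \<bullet> y)\<^sup>2" if "norm y \<ge> \<delta>" for y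
  proof -
    define n where "n = norm y"
    have n: "n \<ge> \<delta>" "n > 0" using that assms by (auto simp: n_def)
    have "a \<bullet> y \<le> norm a * n" unfolding n_def by (rule norm_cauchy_schwarz)
    also have "\<dots> \<le> norm a * (n * (n ^ 3 / \<delta> ^ 3))"
    proof (intro mult_left_mono)
      have "\<delta> ^ 3 \<le> n ^ 3" using n assms by (intro power_mono) auto
      then have "1 \<le> n ^ 3 / \<delta> ^ 3" using assms by simp
      then show "n \<le> n * (n ^ 3 / \<delta> ^ 3)"
        using mult_left_mono[of 1 "n ^ 3 / \<delta> ^ 3" n] n by simp
    qed simp
    finally have 1: "a \<bullet> y \<le> norm a / \<delta> ^ 3 * n ^ 4"
      by (simp add: power_numeral_reduce mult_ac)
    have "y \<bullet> (A *v y) \<le> norm y * norm (A *v y)" by (rule norm_cauchy_schwarz)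
    also have "\<dots> \<le> n * (n * B)" unfolding n_def by (intro mult_left_mono B norm_ge_zero)
    also have "\<dots> = B * n\<^sup>2" by (simp add: power2_eq_square)
    also have "\<dots> \<le> B * (n\<^sup>2 * (n\<^sup>2 / \<delta>\<^sup>2))"
    proof (intro mult_left_mono)
      have "\<delta>\<^sup>2 \<le> n\<^sup>2" using n assms by (intro power_mono) auto
      then have "1 \<le> n\<^sup>2 / \<delta>\<^sup>2" using assms by simp
      then show "n\<^sup>2 \<le> n\<^sup>2 * (n\<^sup>2 / \<delta>\<^sup>2)"
        using mult_left_mono[of 1 "n\<^sup>2 / \<delta>\<^sup>2" "n\<^sup>2"] by simp
    qed (use B in simp)
    finally have 2: "(y \<bullet> (A *v y)) / 2 \<le> B / (2 * \<delta>\<^sup>2) * n ^ 4"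
      by (simp add: power_numeral_reduce mult_ac)
    have "(y \<bullet> y)\<^sup>2 = n ^ 4" by (simp add: n_def dot_square_norm flip: power_mult)
    then show ?thesis using 1 2 by (simp add: C_def distrib_right)
  qed
  moreover have "C \<ge> 0" using assms B by (simp add: C_def)
  ultimately show ?thesis using that by blast
qed

text \<open>The Hessian at \<open>p\<close> is prescribed first, to make \<open>P_minus\<close>
  positive; the local graph estimate then fixes a radius, and the quartic coefficient takes care of
  all points beyond it.\<close>

lemma exists_test_function:
  fixes f :: "real^'m \<Rightarrow> real" and p :: "real^'n"
  assumes G: "local_graph \<Omega> U p \<rho> r f" and card: "CARD('n) = CARD('m) + 1"
    and k: "1 \<le> k" "k \<le> CARD('m)"
    and curv: "(\<Sum>i=1..k. eigenvalue (hessian f 0) (CARD('m) + 1 - i)) < 0"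
  obtains \<phi> :: "real^'n \<Rightarrow> real" where "\<And>S. C2_on S \<phi>" "\<phi> p = 0" "\<And>x. x \<in> - U \<Longrightarrow> \<phi> x \<le> 0"
    "P_minus k (hessian \<phi> p) > 0"
proof -
  let ?H = "hessian f 0" and ?m = "CARD('m)"
  note f = local_graphD(6-8,4)[OF G] and \<rho> = local_graphD(1-3)[OF G]
  obtain L M where lin: "linear L" "linear M" and LM': "\<forall>y. \<rho> (p + y) = L y"
    "\<forall>y. M (L y) = y" "\<forall>z. L (M z) = z"
    and iso': "\<forall>x y. L x \<bullet> L y = x \<bullet> y" "\<forall>x y. M x \<bullet> M y = x \<bullet> y"
    by (rule surj_isometry_imp_linear[OF \<rho>])
  note LM = LM'[rule_format] and iso = iso'[rule_format]
  have H: "transpose ?H = ?H" using hessian_symmetric[OF open_ball _ f(1), of 0] f(4) by simp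
  then obtain e where e: "orthonormal_on {1..?m} e"
    "\<forall>i\<in>{1..?m}. ?H *v e i = eigenvalue ?H i *\<^sub>R e i"
    "mono_on {1..?m} (eigenvalue ?H)"
    by (rule symmetric_matrix_spectral)
  \<comment> \<open>The indices of the \<open>k\<close> largest eigenvalues of \<open>?H\<close>,
    which give the smallest tangential eigenvalues after the change of sign.\<close>
  define K where "K = {?m + 1 - k..?m}"
  define s where "s = (\<Sum>j\<in>K. eigenvalue ?H j)"
  have "(\<Sum>i=1..k. eigenvalue ?H (?m + 1 - i)) = s"
    unfolding s_def K_def
    by (rule sum.reindex_bij_witness[of _ "\<lambda>j. ?m + 1 - j" "\<lambda>i. ?m + 1 - i"]) (use k in auto)
  then have s: "s < 0" using curv by simp
  \<comment> \<open>The perturbation uses up half of the gap: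
    \<open>- s - k * \<epsilon> = - s / 2\<close>.\<close>
  define \<epsilon> where "\<epsilon> = - s / (2 * k)"
  have \<epsilon>: "\<epsilon> > 0" using s k by (simp add: \<epsilon>_def divide_neg_pos)
  \<comment> \<open>Large enough for the normal eigenvalue \<open>2 * c\<close> to be at least the
    threshold \<open>b\<close> used below.\<close>
  define c where "c = \<bar>eigenvalue ?H (?m + 1 - k)\<bar> + 1"
  have c: "c > 0" by (simp add: c_def add_nonneg_pos)
  \<comment> \<open>The Hessian of the quadratic part in graph coordinates; \<open>A\<close> is its
    conjugate in the original coordinates.\<close>
  define T :: "(real^'m) \<times> real \<Rightarrow> (real^'m) \<times> real"
    where "T z = (- (?H *v fst z + \<epsilon> *\<^sub>R fst z), 2 * c * snd z)" for z
  have linT: "linear T"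
    by (rule linearI) (auto simp: T_def matrix_vector_right_distrib matrix_vector_mult_scaleR algebra_simps)
  have adjT: "T x \<bullet> y = T y \<bullet> x" for x y
    using symmetric_matrix_inner[OF H, of "fst x" "fst y"]
    by (simp add: T_def inner_prod_def inner_diff_left inner_diff_right inner_commute)
  define A :: "real^'n^'n" where "A = matrix (\<lambda>y. M (T (L y)))"
  have "linear (\<lambda>y. M (T (L y)))"
    using linear_compose[OF linear_compose[OF lin(1) linT] lin(2)] by (simp add: o_def)
  then have A: "A *v y = M (T (L y))" for y by (simp add: A_def matrix_works)
  have A_inner: "x \<bullet> (A *v y) = L x \<bullet> T (L y)" for x y
    using iso(1)[of x "A *v y"] by (simp add: A LM)
  have symA: "transpose A = A"
  proof (rule symmetric_matrixI)
    fix x y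
    show "x \<bullet> (A *v y) = y \<bullet> (A *v x)"
      using adjT[of "L x" "L y"] by (simp add: A_inner inner_commute)
  qed
  have pos: "P_minus k A > 0"
  proof -
    obtain v where v: "orthonormal_on {1..k} v" "P_minus k A = (\<Sum>i=1..k. v i \<bullet> (A *v v i))"
      using P_minus_eq_trace[OF symA, of k] card k by auto
    \<comment> \<open>Index \<open>?m + 1\<close> stands for the normal direction. The eigenvalues
      \<open>\<mu>\<close> need not be sorted, as only the threshold \<open>b\<close> separates
      \<open>K\<close> from the other indices.\<close>
    define e' where "e' j = (if j \<le> ?m then (e j, 0) else (0, 1::real))" for j
    define \<mu> where "\<mu> j = (if j \<le> ?m then - eigenvalue ?H j - \<epsilon> else 2 * c)" for j
    define b where "b = - eigenvalue ?H (?m + 1 - k) - \<epsilon>"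
    have "(\<Sum>j\<in>K. \<mu> j) \<le> (\<Sum>i=1..k. L (v i) \<bullet> T (L (v i)))"
    proof (rule Ky_Fan_lower_bound[where J = "{1..?m + 1}" and e = e' and c = b])
      show "orthonormal_on {1..k} (\<lambda>i. L (v i))"
        using v(1) by (simp add: orthonormal_on_def iso)
      show "orthonormal_on {1..?m + 1} e'"
        using e(1) by (auto simp: orthonormal_on_def e'_def inner_prod_def)
      show "T (e' j) = \<mu> j *\<^sub>R e' j" if "j \<in> {1..?m + 1}" for j
        using that e(2) by (auto simp: T_def e'_def \<mu>_def algebra_simps)
      show "\<mu> j \<le> b" if "j \<in> K" for j
        using that k mono_onD[OF e(3), of "?m + 1 - k" j] by (auto simp: K_def \<mu>_def b_def)
      show "b \<le> \<mu> j" if j: "j \<in> {1..?m + 1} - K" for j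
      proof (cases "j \<le> ?m")
        case True
        then have "eigenvalue ?H j \<le> eigenvalue ?H (?m + 1 - k)"
          using j k by (intro mono_onD[OF e(3)]) (auto simp: K_def)
        then show ?thesis using True by (simp add: b_def \<mu>_def)
      qed (use \<epsilon> in \<open>simp add: b_def \<mu>_def c_def\<close>)
    qed (use k linT in \<open>auto simp: K_def\<close>)
    moreover have "(\<Sum>j\<in>K. \<mu> j) = - s - k * \<epsilon>"
    proof -
      have "(\<Sum>j\<in>K. \<mu> j) = (\<Sum>j\<in>K. - eigenvalue ?H j - \<epsilon>)"
        by (rule sum.cong) (auto simp: K_def \<mu>_def)
      moreover have "card K = k" using k by (simp add: K_def)
      ultimately show ?thesis by (simp add: sum_subtractf sum_negf s_def)
    qed
    moreover have "- s - k * \<epsilon> > 0" using s k by (simp add: \<epsilon>_def)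
    ultimately show ?thesis by (simp add: v(2) A_inner)
  qed
  obtain \<delta> where \<delta>: "0 < \<delta>" "\<delta> \<le> r" "\<And>w t. norm (w, t) < \<delta> \<Longrightarrow> t \<le> f w \<Longrightarrow>
      t + c * t\<^sup>2 \<le> (w \<bullet> (?H *v w)) / 2 + \<epsilon> / 2 * (w \<bullet> w)"
    using below_graph_quadratic_bound[OF f c \<epsilon>] by metis
  define a where "a = M (0, 1)"
  obtain C where C: "C \<ge> 0" "\<And>y. norm y \<ge> \<delta> \<Longrightarrow> a \<bullet> y + (y \<bullet> (A *v y)) / 2 \<le> C * (y \<bullet> y)\<^sup>2"
    using far_quartic_bound[OF \<delta>(1)] by metis
  define \<phi> where "\<phi> x = a \<bullet> (x - p) + ((x - p) \<bullet> (A *v (x - p))) / 2 - C * ((x - p) \<bullet> (x - p))\<^sup>2" for x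
  have "\<phi> x \<le> 0" if "x \<in> - U" for x
  \<comment> \<open>Near \<open>p\<close> the graph estimate makes the quadratic part nonpositive
    and the quartic only helps; elsewhere the quartic dominates.\<close>
  proof (cases "norm (x - p) < \<delta>")
    case True
    obtain w t where wt: "L (x - p) = (w, t)" by (cases "L (x - p)")
    have x: "x = p + M (w, t)" using LM(2)[of "x - p"] wt by simp
    have norm: "norm (w, t) < \<delta>"
      using True iso(1)[of "x - p" "x - p"] wt by (simp add: norm_eq_sqrt_inner)
    then have "t \<le> f w"
      using local_graph_mem(2)[OF G LM, of "(w, t)"] that x \<delta>(2) by auto
    then have "t + c * t\<^sup>2 \<le> (w \<bullet> (?H *v w)) / 2 + \<epsilon> / 2 * (w \<bullet> w)"
      using \<delta>(3) norm by blast
    moreover have "a \<bullet> (x - p) = t"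
      using iso(1)[of a "x - p"] wt by (simp add: a_def LM inner_prod_def)
    moreover have "(x - p) \<bullet> (A *v (x - p)) = - (w \<bullet> (?H *v w)) - \<epsilon> * (w \<bullet> w) + 2 * c * t\<^sup>2"
      unfolding A_inner wt
      by (simp add: T_def inner_prod_def inner_add_right inner_diff_right power2_eq_square)
    moreover have "C * ((x - p) \<bullet> (x - p))\<^sup>2 \<ge> 0" using C(1) by simp
    ultimately show ?thesis unfolding \<phi>_def by (simp add: field_simps)
  next
    case False
    then show ?thesis using C(2)[of "x - p"] by (simp add: \<phi>_def)
  qed
  moreover have "C2_on S \<phi>" for S
    unfolding \<phi>_def[abs_def] by (rule quadratic_minus_quartic(1)[OF symA])
  moreover have "hessian \<phi> p = A"
    unfolding \<phi>_def[abs_def] by (rule quadratic_minus_quartic(2)[OF symA])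
  moreover have "\<phi> p = 0" by (simp add: \<phi>_def)
  ultimately show ?thesis using that[of \<phi>] pos by simp
qed

section \<open>Both implications assembled\<close>

theorem theorem4:
  fixes \<Omega> U :: "(real^'n) set"
    and k :: nat
    and \<kappa> :: "nat \<Rightarrow> real^'n \<Rightarrow> real"
  assumes "CARD('n) = CARD('m::finite) + 1"
    and "1 \<le> k" and "k < CARD('n)"
    and "open \<Omega>"
    and "smooth_subdomain TYPE('m) \<Omega> U"
    and "\<And>p. p \<in> \<Omega> \<inter> frontier U \<Longrightarrow>
           principal_curvatures_at TYPE('m) \<Omega> U p (\<lambda>i. \<kappa> i p)"
  shows "(\<forall>p\<in>\<Omega> \<inter> frontier U. (\<Sum>i=1..k. \<kappa> (CARD('n) - i) p) \<ge> 0)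
           \<longleftrightarrow> condition_G k \<Omega> U"
proof -
  have U: "open U" using assms(5) by (simp add: smooth_subdomain_def)
  have km: "k \<le> CARD('m)" using assms(1,3) by simp
  have graph: "\<exists>\<rho> r (f :: real^'m \<Rightarrow> real). local_graph \<Omega> U p \<rho> r f \<and>
      (\<Sum>i=1..k. \<kappa> (CARD('n) - i) p) = (\<Sum>i=1..k. eigenvalue (hessian f 0) (CARD('m) + 1 - i))"
    if p: "p \<in> \<Omega> \<inter> frontier U" for p
  proof -
    obtain \<rho> r and f :: "real^'m \<Rightarrow> real" where G: "local_graph \<Omega> U p \<rho> r f"
      and \<kappa>: "\<forall>i\<in>{1..CARD('m)}. \<kappa> i p = eigenvalue (hessian f 0) i"
      using assms(6)[OF p] by (auto simp: principal_curvatures_at_def)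
    have "(\<Sum>i=1..k. \<kappa> (CARD('n) - i) p) = (\<Sum>i=1..k. eigenvalue (hessian f 0) (CARD('m) + 1 - i))"
    proof (rule sum.cong)
      fix i assume "i \<in> {1..k}"
      then have "CARD('m) + 1 - i \<in> {1..CARD('m)}" using km by auto
      then show "\<kappa> (CARD('n) - i) p = eigenvalue (hessian f 0) (CARD('m) + 1 - i)"
        unfolding assms(1) by (rule \<kappa>[rule_format])
    qed simp
    then show ?thesis using G by blast
  qed
  show ?thesis
  proof
    assume curv: "\<forall>p\<in>\<Omega> \<inter> frontier U. (\<Sum>i=1..k. \<kappa> (CARD('n) - i) p) \<ge> 0"
    show "condition_G k \<Omega> U"
      unfolding condition_G_def
    proof (intro allI impI)
      fix \<phi> z
      assume \<phi>: "C2_on \<Omega> \<phi>" and z: "z \<in> \<Omega> - U" and max: "\<forall>x\<in>\<Omega> - U. \<phi> x \<le> \<phi> z"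
      show "P_minus k (hessian \<phi> z) \<le> 0"
      proof (cases "z \<in> frontier U")
        case True
        then obtain \<rho> r and f :: "real^'m \<Rightarrow> real" where G: "local_graph \<Omega> U z \<rho> r f"
          and eq: "(\<Sum>i=1..k. \<kappa> (CARD('n) - i) z) = (\<Sum>i=1..k. eigenvalue (hessian f 0) (CARD('m) + 1 - i))"
          using graph z by blast
        have "(\<Sum>i=1..k. eigenvalue (hessian f 0) (CARD('m) + 1 - i)) \<ge> 0"
          using curv True z eq by (metis DiffD1 IntI)
        then show ?thesis
          using z max assms(2,3) km by (intro P_minus_hessian_le_0_boundary[OF assms(4) \<phi> _ _ G]) auto
      next
        case False
        \<comment> \<open>Off the frontier, \<open>z\<close> has a whole neighbourhood in the
          complement of \<open>U\<close>, so \<open>\<phi>\<close> has an ordinary local maximum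
          there.\<close>
        then have "z \<in> \<Omega> - closure U" using z U by (simp add: frontier_def interior_open)
        moreover have "open (\<Omega> - closure U)" using assms(4) by (simp add: open_Diff)
        moreover have "C2_on (\<Omega> - closure U) \<phi>"
          using \<phi> by (auto simp: C2_on_def intro: continuous_on_subset)
        ultimately show ?thesis
          using max closure_subset[of U] assms(3)
          by (intro P_minus_hessian_le_0_interior[of "\<Omega> - closure U"]) auto
      qed
    qed
  next
    assume cond: "condition_G k \<Omega> U"
    show "\<forall>p\<in>\<Omega> \<inter> frontier U. (\<Sum>i=1..k. \<kappa> (CARD('n) - i) p) \<ge> 0"
    proof (rule ballI, rule ccontr)
      fix p assume p: "p \<in> \<Omega> \<inter> frontier U" and neg: "\<not> (\<Sum>i=1..k. \<kappa> (CARD('n) - i) p) \<ge> 0"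
      obtain \<rho> r and f :: "real^'m \<Rightarrow> real" where G: "local_graph \<Omega> U p \<rho> r f"
        and "(\<Sum>i=1..k. \<kappa> (CARD('n) - i) p) = (\<Sum>i=1..k. eigenvalue (hessian f 0) (CARD('m) + 1 - i))"
        using graph p by blast
      then have "(\<Sum>i=1..k. eigenvalue (hessian f 0) (CARD('m) + 1 - i)) < 0" using neg by simp
      then obtain \<phi> :: "real^'n \<Rightarrow> real" where "\<And>S. C2_on S \<phi>" "\<phi> p = 0" "\<And>x. x \<in> - U \<Longrightarrow> \<phi> x \<le> 0"
        and pos: "P_minus k (hessian \<phi> p) > 0"
        using exists_test_function[OF G assms(1,2) km] by metis
      \<comment> \<open>As \<open>U\<close> is open, its frontier points lie outside it, so
        \<open>p\<close> is admissible in condition G.\<close>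
      moreover have "p \<in> \<Omega> - U" using p U by (simp add: frontier_def interior_open)
      ultimately have "P_minus k (hessian \<phi> p) \<le> 0"
        using cond by (simp add: condition_G_def)
      then show False using pos by simp
    qed
  qed
qed

end
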